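(* There exists $N$ such that for all integers $n\ge N$, under the optimal strategy with Yes/No feedback, $\mathbb{E}[S_{2,n}]\ge 2.91$ and $\mathbb{E}[S_{3,n}]\ge 3.97$. That is, for all sufficiently large $n$, $\max_{\mathcal{G}}\mathbb{E}[S(\mathcal{G},\boldsymbol{\pi})]\ge 2.91$ when $\boldsymbol{\pi}$ is uniform on $\mathfrak{S}_{2,n}$, and $\max_{\mathcal{G}}\mathbb{E}[S(\mathcal{G},\boldsymbol{\pi})]\ge 3.97$ when $\boldsymbol{\pi}$ is uniform on $\mathfrak{S}_{3,n}$, where the maxima range over all strategies $\mathcal{G}$ with Yes/No feedback.
   Context: Let $[n]=\{1,\dots,n\}$ and let $\mathfrak{S}_{m,n}$ be the set of all words $\pi=\pi_1\pi_2\cdots\pi_{mn}$ containing exactly $m$ copies of each element of $[n]$ (a shuffled deck of $mn$ cards with $n$ card types, each of multiplicity $m$). Let $\boldsymbol{\pi}$ be a uniformly random element of $\mathfrak{S}_{m,n}$. In the Yes/No feedback game, at each time $t=1,\dots,mn$ the player guesses the value of $\pi_t$ by naming an element of $[n]$, and is then told only whether the guess was correct or not. A strategy $\mathcal{G}$ with Yes/No feedback is a rule determining each guess from the feedback received so far, i.e. a sequence of functions $g_t:\{0,1\}^{t-1}\to[n]$, $1\le t\le mn$, where the guess at time $t$ is $g_t(x_1,\dots,x_{t-1})$ and $x_s=1$ if the $s$th guess was correct and $x_s=0$ otherwise. $S(\mathcal{G},\pi)$ is the total number of correct guesses when strategy $\mathcal{G}$ is used on $\pi$, and $S_{m,n}=S(\mathcal{G},\boldsymbol{\pi})$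 for the strategy in question. An optimal strategy is one attaining $\max_{\mathcal{G}}\mathbb{E}[S(\mathcal{G},\boldsymbol{\pi})]$. *)

theory Defs
  imports "HOL-Probability.Probability"
begin

definition decks :: "nat \<Rightarrow> nat \<Rightarrow> nat list set" where
  "decks m n =
     {w. length w = m * n \<and> set w \<subseteq> {1..n} \<and> (\<forall>i\<in>{1..n}. count_list w i = m)}"

text \<open>
  A strategy is a single function on feedback histories: its value at a history
  \<open>[x\<^sub>1, \<dots>, x\<^sub>s]\<close> (oldest answer first, \<open>True\<close> for a correct guess) with
  \<open>s < m * n\<close> is the guess at time \<open>s + 1\<close>. The restriction of this function to the histories
  of length \<open>t - 1\<close> is the component \<open>g\<^sub>t\<close>. Using the extensional function space makes
  the set of strategies finite, so that the maximum below is a maximum over a finite set.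
\<close>

definition strategies :: "nat \<Rightarrow> nat \<Rightarrow> (bool list \<Rightarrow> nat) set" where
  "strategies m n = {xs. length xs < m * n} \<rightarrow>\<^sub>E {1..n}"

text \<open>
  \<open>feedback g w t\<close> is the list of the first \<open>t\<close> answers. List positions start at 0, so the
  card turned up at time \<open>t + 1\<close> is \<open>w ! t\<close>.
\<close>

primrec feedback :: "(bool list \<Rightarrow> nat) \<Rightarrow> nat list \<Rightarrow> nat \<Rightarrow> bool list" where
  "feedback g w 0 = []"
| "feedback g w (Suc t) = feedback g w t @ [g (feedback g w t) = w ! t]"

definition score :: "(bool list \<Rightarrow> nat) \<Rightarrow> nat list \<Rightarrow> nat" where
  "score g w = card {t. t < length w \<and> g (feedback g w t) = w ! t}"

definition expected_score :: "nat \<Rightarrow> nat \<Rightarrow> (bool list \<Rightarrow> nat) \<Rightarrow> real" where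
  "expected_score m n g =
     measure_pmf.expectation (pmf_of_set (decks m n)) (\<lambda>w. real (score g w))"

definition optimal_expected_score :: "nat \<Rightarrow> nat \<Rightarrow> real" where
  "optimal_expected_score m n = Max (expected_score m n ` strategies m n)"

lemma finite_decks: "finite (decks m n)"
  by (rule finite_subset[OF _ finite_lists_length_eq[of "{1..n}" "m * n"]])
     (auto simp: decks_def)

lemma decks_nonempty: "decks m n \<noteq> {}"
proof -
  have cr: "count_list (replicate k a) i = (if a = i then k else 0)" for k and a i :: nat
    by (induction k) auto
  have "\<exists>w. w \<in> decks m n"
  proof (induction n)
    case 0
    have "[] \<in> decks m 0" by (simp add: decks_def)
    then show ?case by blast
  next
    case (Suc n)
    then obtain u where u: "u \<in> decks m n" by blast
    then have "count_list u (Suc n) = 0"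
      by (auto simp: decks_def count_list_0_iff)
    with u have "u @ replicate m (Suc n) \<in> decks m (Suc n)"
      by (auto simp: decks_def cr le_Suc_eq)
    then show ?case by blast
  qed
  then show ?thesis by blast
qed

lemma finite_strategies: "finite (strategies m n)"
proof -
  have "finite {xs :: bool list. set xs \<subseteq> UNIV \<and> length xs \<le> m * n}"
    by (rule finite_lists_length_le) simp
  then have "finite {xs :: bool list. length xs < m * n}"
    by (rule finite_subset[rotated]) auto
  then show ?thesis
    unfolding strategies_def by (intro finite_PiE) auto
qed

lemma strategies_nonempty: "strategies m n \<noteq> {}"
  by (cases "n = 0") (auto simp: strategies_def PiE_eq_empty_iff)

lemma optimal_expected_score_attained:
  "\<exists>g\<in>strategies m n. expected_score m n g = optimal_expected_score m n \<and>
     (\<forall>h\<in>strategies m n. expected_score m n h \<le> expected_score m n g)"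
proof -
  have fin: "finite (expected_score m n ` strategies m n)"
    using finite_strategies by blast
  have "optimal_expected_score m n \<in> expected_score m n ` strategies m n"
    unfolding optimal_expected_score_def
    by (rule Max_in[OF fin]) (simp add: strategies_nonempty)
  then obtain g where g: "g \<in> strategies m n" "expected_score m n g = optimal_expected_score m n"
    by auto
  have "expected_score m n h \<le> expected_score m n g" if "h \<in> strategies m n" for h
    using g(2) fin that by (auto simp: optimal_expected_score_def)
  with g show ?thesis by blast
qed

end

theory Submission
  imports Defs "HOL-Combinatorics.Permutations"
begin

text \<open>
  Let \<open>N = m n\<close>. Guess type 1 until it is hit. If that happens before time \<open>N / 4\<close>, switch to
  type 2; otherwise keep guessing type 1 until all its \<open>m\<close> copies are found, and only then switch.
  From type 2 on, move to the next type after every hit.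

  As \<open>n \<rightarrow> \<infinity>\<close>, the rescaled positions of finitely many types become independent and uniform on
  \<open>[0, 1]\<close>: by symmetry under permutations of the positions, they form a uniformly random injective
  tuple, which differs from a uniformly random tuple only by a collision probability tending to 0.
  In the limit, the expected number of hits collected from time \<open>t\<close> on by moving on after every hit
  satisfies \<open>V(t) = \<integral> m (1 + t - x)^(m - 1) (1 + V(x)) dx\<close>, integrated over \<open>t \<le> x \<le> 1\<close>, so it is
  bounded below by every \<open>p\<close> that satisfies this equation with \<open>\<le>\<close> in place of \<open>=\<close>. Polynomials of
  degree 4 suffice. With threshold \<open>c\<close>, the whole strategy then collects at least
  \<open>\<integral> m (1 - x)^(m - 1) (1 + p(x)) dx\<close> over \<open>[0, c]\<close> plus
  \<open>\<integral> m (x - c)^(m - 1) (m + p(x)) dx\<close> over \<open>[c, 1]\<close>, and at \<open>c = 1 / 4\<close> this exceeds 2.937 for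
  \<open>m = 2\<close> and 3.990 for \<open>m = 3\<close>.
\<close>

section \<open>The threshold strategy\<close>

definition hits :: "(bool list \<Rightarrow> nat) \<Rightarrow> nat list \<Rightarrow> nat \<Rightarrow> nat" where
  "hits g w t = count_list (feedback g w t) True"

lemma length_feedback [simp]: "length (feedback g w t) = t"
  by (induction t) auto

lemma hits_0 [simp]: "hits g w 0 = 0"
  by (simp add: hits_def)

lemma hits_Suc: "hits g w (Suc t) = hits g w t + (if g (feedback g w t) = w ! t then 1 else 0)"
  by (simp add: hits_def)

lemma hits_eq_card: "hits g w t = card {s. s < t \<and> g (feedback g w s) = w ! s}"
proof (induction t)
  case (Suc t)
  have "{s. s < Suc t \<and> g (feedback g w s) = w ! s} =
     (if g (feedback g w t) = w ! t then insert t {s. s < t \<and> g (feedback g w s) = w ! s}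
      else {s. s < t \<and> g (feedback g w s) = w ! s})"
    by (auto simp: less_Suc_eq)
  then show ?case using Suc by (simp add: hits_Suc)
qed simp

lemma score_eq_hits: "score g w = hits g w (length w)"
  by (simp add: score_def hits_eq_card)

lemma hits_mono: "s \<le> t \<Longrightarrow> hits g w s \<le> hits g w t"
  by (rule lift_Suc_mono_le[of "hits g w"]) (auto simp: hits_Suc)

lemma feedback_take: "s \<le> t \<Longrightarrow> take s (feedback g w t) = feedback g w s"
proof (induction t)
  case (Suc t)
  then show ?case by (cases "s = Suc t") auto
qed simp

definition occurrences :: "nat list \<Rightarrow> nat \<Rightarrow> nat set" where
  "occurrences w j = {p. p < length w \<and> w ! p = j}"

text \<open>Hits collected from time \<open>t\<close> on by guessing the listed types in turn,
  moving on after every hit. Types enter only through their position sets, so the count also makes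
  sense for random positions that may coincide and belong to no deck.\<close>

fun chain :: "nat \<Rightarrow> nat set list \<Rightarrow> nat" where
  "chain t [] = 0"
| "chain t (P # Ps) =
     (if \<exists>p\<in>P. t \<le> p then Suc (chain (Suc (LEAST p. p \<in> P \<and> t \<le> p)) Ps) else 0)"

lemma chain_le_length: "chain t Ps \<le> length Ps"
  by (induction Ps arbitrary: t) auto

text \<open>Until the first copy of type \<open>i\<close> at or after \<open>t\<close> nothing is
  hit, so the guess stays \<open>i\<close>; that copy is a hit, and the induction restarts one
  position later with type \<open>i + 1\<close>. Hits beyond these \<open>k\<close> types are
  ignored, hence only an inequality.\<close>

lemma hits_ge_chain:
  assumes "\<And>s. t \<le> s \<Longrightarrow> s < length w \<Longrightarrow> i + (hits g w s - hits g w t) \<le> n \<Longrightarrow>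
             g (feedback g w s) = i + (hits g w s - hits g w t)"
    and "i + k \<le> Suc n" and "t \<le> length w"
  shows "hits g w t + chain t (map (occurrences w) [i..<i + k]) \<le> hits g w (length w)"
  using assms
proof (induction k arbitrary: i t)
  case 0
  then show ?case by (simp add: hits_mono)
next
  case (Suc k)
  have split: "[i..<i + Suc k] = i # [Suc i..<Suc i + k]"
    by (simp add: upt_conv_Cons)
  show ?case
  proof (cases "\<exists>p\<in>occurrences w i. t \<le> p")
    case False
    then show ?thesis using Suc.prems(3) unfolding split by (simp add: hits_mono)
  next
    case True
    define a where "a = (LEAST p. p \<in> occurrences w i \<and> t \<le> p)"
    have "a \<in> occurrences w i \<and> t \<le> a"
      unfolding a_def by (rule LeastI_ex) (use True in auto)
    then have a: "a < length w" "w ! a = i" "t \<le> a"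
      by (auto simp: occurrences_def)
    have before: "w ! s \<noteq> i" if "t \<le> s" "s < a" for s
    proof
      assume "w ! s = i"
      then have "a \<le> s"
        unfolding a_def using that a by (intro Least_le) (auto simp: occurrences_def)
      then show False using that by simp
    qed
    have const: "hits g w s = hits g w t" if "t \<le> s" "s \<le> a" for s
      using that
    proof (induction s rule: dec_induct)
      case (step s)
      then have "g (feedback g w s) = i"
        using Suc.prems(1)[of s] Suc.prems(2) a by simp
      then show ?case using step before[of s] by (auto simp: hits_Suc)
    qed simp
    have "g (feedback g w a) = i"
      using Suc.prems(1)[of a] Suc.prems(2) a const[of a] by simp
    then have hit: "hits g w (Suc a) = Suc (hits g w t)"
      using a const[of a] by (simp add: hits_Suc)
    have "hits g w (Suc a) + chain (Suc a) (map (occurrences w) [Suc i..<Suc i + k])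
            \<le> hits g w (length w)"
    proof (rule Suc.IH)
      show "Suc i + k \<le> Suc n" "Suc a \<le> length w"
        using Suc.prems a by auto
      fix s assume s: "Suc a \<le> s" "s < length w" "Suc i + (hits g w s - hits g w (Suc a)) \<le> n"
      then have "hits g w (Suc a) \<le> hits g w s" by (intro hits_mono)
      with s hit Suc.prems(1)[of s] a
      show "g (feedback g w s) = Suc i + (hits g w s - hits g w (Suc a))"
        by simp
    qed
    then show ?thesis
      using True hit unfolding split by (simp add: a_def)
  qed
qed

text \<open>\<open>length (takeWhile Not xs)\<close> is the time of the first hit, counted from 0,
  or the length of the history if there is none. Without a hit every branch yields 1, provided
  \<open>0 < m\<close>.\<close>

definition target :: "nat \<Rightarrow> nat \<Rightarrow> bool list \<Rightarrow> nat" where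
  "target m b xs =
     (if length (takeWhile Not xs) < b then Suc (count_list xs True)
      else if count_list xs True < m then 1 else count_list xs True - m + 2)"

text \<open>For \<open>0 < n\<close>, the fallback guess 1 keeps the values in \<open>{1..n}\<close>
  once the types have run out.\<close>

definition threshold_strategy :: "nat \<Rightarrow> nat \<Rightarrow> nat \<Rightarrow> bool list \<Rightarrow> nat" where
  "threshold_strategy m n b =
     restrict (\<lambda>xs. if target m b xs \<le> n then target m b xs else 1) {xs. length xs < m * n}"

lemma threshold_strategy_in: "0 < n \<Longrightarrow> threshold_strategy m n b \<in> strategies m n"
  by (auto simp: threshold_strategy_def strategies_def target_def)

text \<open>\<open>P\<close> holds the positions of type 1: its first copy decides between leaving
  after one hit and staying until the last copy.\<close>

definition two_phase :: "nat \<Rightarrow> nat \<Rightarrow> nat set \<Rightarrow> nat set list \<Rightarrow> nat" where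
  "two_phase m b P Ps =
     (if Min P < b then 1 + chain (Suc (Min P)) Ps else m + chain (Suc (Max P)) Ps)"

lemma card_occurrences: "card (occurrences w j) = count_list w j"
proof -
  have "count_list w j = length (filter (\<lambda>x. x = j) w)"
    by (induction w) auto
  then show ?thesis
    by (simp add: occurrences_def length_filter_conv_card)
qed

lemma finite_occurrences [simp]: "finite (occurrences w j)"
  by (simp add: occurrences_def)

text \<open>The first hit is the first copy of type 1, at time \<open>a\<close>. If
  \<open>a < b\<close>, the guess is from then on one more than the number of hits and so runs
  through 2, 3 and so on; otherwise type 1 is guessed up to its last copy, which brings all
  \<open>m\<close> hits. In both cases \<open>hits_ge_chain\<close> covers the rest.\<close>

lemma two_phase_le_score:
  assumes w: "w \<in> decks m n" and m: "0 < m" and k: "Suc k \<le> n"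
  shows "two_phase m b (occurrences w 1) (map (occurrences w) [2..<2 + k])
           \<le> score (threshold_strategy m n b) w"
proof -
  define g where "g = threshold_strategy m n b"
  define h where "h = hits g w"
  define P where "P = occurrences w 1"
  have len: "length w = m * n" using w by (simp add: decks_def)
  have cardP: "card P = m"
    using w k by (auto simp: P_def card_occurrences decks_def)
  then have fin: "finite P" "P \<noteq> {}" using m by (auto simp: P_def)
  define a where "a = Min P"
  have "a \<in> P" using fin by (simp add: a_def)
  then have a: "a < length w" "w ! a = 1" by (auto simp: P_def occurrences_def)
  have guess: "g (feedback g w s) =
      (if target m b (feedback g w s) \<le> n then target m b (feedback g w s) else 1)"
    if "s < length w" for s
    using that by (simp add: g_def threshold_strategy_def len)
  have before: "w ! s \<noteq> 1" if "s < a" for s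
  proof
    assume "w ! s = 1"
    then have "s \<in> P" using that a by (simp add: P_def occurrences_def)
    then show False using that Min_le[OF fin(1) \<open>s \<in> P\<close>] by (simp add: a_def)
  qed
  have none: "h s = 0" if "s \<le> a" for s
    using that
  proof (induction s)
    case (Suc s)
    then have "h s = 0" by simp
    then have "target m b (feedback g w s) = 1"
      using m by (simp add: target_def h_def hits_def)
    then show ?case
      using \<open>h s = 0\<close> before[of s] Suc.prems a k guess[of s] by (simp add: h_def hits_Suc)
  qed (simp add: h_def)
  have "target m b (feedback g w a) = 1"
    using m none[of a] by (simp add: target_def h_def hits_def)
  then have ga: "g (feedback g w a) = 1" using guess[of a] a k by simp
  \<comment> \<open>After the first hit this length stays frozen at \<open>a\<close>, so the choice
    between the two phases is made once and for all.\<close>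
  have takeWhile: "length (takeWhile Not (feedback g w s)) = a" if "a < s" for s
  proof -
    have "feedback g w s = take (Suc a) (feedback g w s) @ drop (Suc a) (feedback g w s)"
      by simp
    also have "take (Suc a) (feedback g w s) = feedback g w a @ [True]"
      using that ga a by (simp add: feedback_take Suc_le_eq)
    finally have *: "feedback g w s = (feedback g w a @ [True]) @ drop (Suc a) (feedback g w s)" .
    have "True \<notin> set (feedback g w a)"
      using none[of a] by (simp add: h_def hits_def count_list_0_iff)
    then have "takeWhile Not (feedback g w s) = feedback g w a"
      by (subst *) (simp, subst takeWhile_append2, auto)
    then show ?thesis by simp
  qed
  have hSa: "h (Suc a) = 1"
    using none[of a] ga a by (simp add: h_def hits_Suc)
  have "two_phase m b P (map (occurrences w) [2..<2 + k]) \<le> h (length w)"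
  proof (cases "a < b")
    case True
    have "h (Suc a) + chain (Suc a) (map (occurrences w) [2..<2 + k]) \<le> h (length w)"
      unfolding h_def
    proof (rule hits_ge_chain)
      fix s assume s: "Suc a \<le> s" "s < length w" "2 + (hits g w s - hits g w (Suc a)) \<le> n"
      have "1 \<le> hits g w s" using hits_mono[OF s(1), of g w] hSa by (simp add: h_def)
      moreover have "target m b (feedback g w s) = Suc (hits g w s)"
        using takeWhile[of s] s True by (simp add: target_def hits_def)
      ultimately show "g (feedback g w s) = 2 + (hits g w s - hits g w (Suc a))"
        using s hSa guess[of s] by (simp add: h_def)
    qed (use a k in auto)
    then show ?thesis using True hSa by (simp add: two_phase_def a_def[symmetric])
  next
    case False
    define z where "z = Max P"
    have "z \<in> P" using fin by (simp add: z_def)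
    then have z: "z < length w" "w ! z = 1" by (auto simp: P_def occurrences_def)
    have az: "a \<le> z" using \<open>z \<in> P\<close> fin by (simp add: a_def)
    have guess1: "g (feedback g w s) = 1" if "s < length w" "h s < m" for s
    proof -
      have "target m b (feedback g w s) = 1"
      proof (cases "s \<le> a")
        case True
        then show ?thesis using none[of s] m by (simp add: target_def h_def hits_def)
      next
        case F: False
        then show ?thesis using takeWhile[of s] False that by (simp add: target_def h_def hits_def)
      qed
      then show ?thesis using guess[of s] that k by simp
    qed
    have count: "h s = card {p\<in>P. p < s}" if "s \<le> Suc z" for s
      using that
    proof (induction s)
      case 0
      then show ?case by (simp add: h_def)
    next
      case (Suc s)
      \<comment> \<open>The last copy \<open>z\<close> is not yet counted, so fewer than
        \<open>m\<close> hits have occurred and type 1 is still being guessed.\<close>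
      have "z \<notin> {p\<in>P. p < s}" using Suc.prems by simp
      then have "{p\<in>P. p < s} \<noteq> P" using \<open>z \<in> P\<close> by metis
      then have "card {p\<in>P. p < s} < card P"
        using fin by (intro psubset_card_mono psubsetI) simp_all
      then have "g (feedback g w s) = 1"
        using guess1[of s] Suc z cardP by simp
      moreover have "{p\<in>P. p < Suc s} = (if w ! s = 1 then insert s {p\<in>P. p < s} else {p\<in>P. p < s})"
        using Suc.prems z by (auto simp: less_Suc_eq P_def occurrences_def)
      ultimately show ?case
        using Suc fin by (simp add: h_def hits_Suc)
    qed
    have "{p\<in>P. p < Suc z} = P" using fin by (auto simp: z_def less_Suc_eq_le)
    then have hz: "h (Suc z) = m" using count[of "Suc z"] cardP by simp
    have "h (Suc z) + chain (Suc z) (map (occurrences w) [2..<2 + k]) \<le> h (length w)"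
      unfolding h_def
    proof (rule hits_ge_chain)
      fix s assume s: "Suc z \<le> s" "s < length w" "2 + (hits g w s - hits g w (Suc z)) \<le> n"
      have "m \<le> hits g w s" using hits_mono[OF s(1), of g w] hz by (simp add: h_def)
      then have "target m b (feedback g w s) = hits g w s - m + 2"
        using takeWhile[of s] s False az by (simp add: target_def hits_def)
      then show "g (feedback g w s) = 2 + (hits g w s - hits g w (Suc z))"
        using s hz guess[of s] by (simp add: h_def)
    qed (use z k in auto)
    then show ?thesis using False hz by (simp add: two_phase_def a_def[symmetric] z_def)
  qed
  then show ?thesis by (simp add: score_eq_hits g_def h_def P_def)
qed

section \<open>Averaging over permutations of the positions\<close>

text \<open>Repetitions are allowed: a uniform element consists of \<open>m\<close> independent
  uniform positions.\<close>

definition tuples :: "nat \<Rightarrow> nat \<Rightarrow> nat list set" where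
  "tuples m N = {P. set P \<subseteq> {..<N} \<and> length P = m}"

definition blocks :: "nat \<Rightarrow> nat \<Rightarrow> nat \<Rightarrow> nat list list set" where
  "blocks m N k = {Ps. set Ps \<subseteq> tuples m N \<and> length Ps = k}"

lemma finite_tuples [simp]: "finite (tuples m N)"
  unfolding tuples_def by (rule finite_lists_length_eq) simp

lemma card_tuples: "card (tuples m N) = N ^ m"
  unfolding tuples_def by (subst card_lists_length_eq) auto

lemma finite_blocks [simp]: "finite (blocks m N k)"
  unfolding blocks_def by (rule finite_lists_length_eq) simp

lemma card_blocks: "card (blocks m N k) = N ^ (m * k)"
  unfolding blocks_def by (subst card_lists_length_eq) (auto simp: card_tuples power_mult)

lemma sum_blocks_Suc:
  "(\<Sum>Ps\<in>blocks m N (Suc k). f Ps) = (\<Sum>P\<in>tuples m N. \<Sum>Ps\<in>blocks m N k. f (P # Ps))"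
proof -
  have "blocks m N (Suc k) = (\<lambda>(P, Ps). P # Ps) ` (tuples m N \<times> blocks m N k)"
    by (auto simp: blocks_def length_Suc_conv)
  then show ?thesis
    by (simp add: sum.reindex inj_on_def sum.cartesian_product case_prod_unfold)
qed

lemma length_concat_blocks: "Ps \<in> blocks m N k \<Longrightarrow> length (concat Ps) = m * k"
  by (induction Ps arbitrary: k) (auto simp: blocks_def tuples_def)

lemma set_concat_blocks: "Ps \<in> blocks m N k \<Longrightarrow> set (concat Ps) \<subseteq> {..<N}"
  by (auto simp: blocks_def tuples_def)

lemma concat_eq_blocks:
  assumes "Ps \<in> blocks m N k" "Qs \<in> blocks m N k" "concat Ps = concat Qs"
  shows "Ps = Qs"
  using assms(3)
proof (rule concat_injective)
  show "length Ps = length Qs" using assms by (simp add: blocks_def)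
  show "\<forall>(P, Q)\<in>set (zip Ps Qs). length P = length Q"
    using assms(1,2) by (fastforce simp: blocks_def tuples_def dest: set_zip_leftD set_zip_rightD)
qed

text \<open>Induction on the lists: composing with the transposition of \<open>\<tau> x\<close> and
  \<open>y\<close> corrects the value at \<open>x\<close> and leaves the earlier values alone, as
  neither point lies in \<open>set ys\<close>.\<close>

lemma ex_permutes_map_eq:
  assumes "distinct xs" "distinct ys" "length xs = length ys" "set xs \<subseteq> S" "set ys \<subseteq> S"
  shows "\<exists>\<tau>. \<tau> permutes S \<and> map \<tau> xs = ys"
  using assms(3,1,2,4,5)
proof (induction xs ys rule: list_induct2)
  case Nil
  then show ?case using permutes_id by fastforce
next
  case (Cons x xs y ys)
  then obtain \<tau> where \<tau>: "\<tau> permutes S" "map \<tau> xs = ys" by auto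
  define \<sigma> where "\<sigma> = Transposition.transpose (\<tau> x) y \<circ> \<tau>"
  have "\<tau> x \<in> S" using \<tau> Cons.prems by (simp add: permutes_in_image)
  then have perm: "\<sigma> permutes S"
    unfolding \<sigma>_def using \<tau> Cons.prems by (intro permutes_compose permutes_swap_id) auto
  have notin: "\<tau> x \<notin> set ys"
    using \<tau> Cons.prems permutes_inj[OF \<tau>(1)] by (auto dest: injD)
  have "map \<sigma> xs = map \<tau> xs"
  proof (intro map_cong refl)
    fix z assume "z \<in> set xs"
    then have "\<tau> z \<in> set ys" using \<tau>(2) by auto
    then have "\<tau> z \<noteq> \<tau> x" "\<tau> z \<noteq> y" using notin Cons.prems by auto
    then show "\<sigma> z = \<tau> z" by (simp add: \<sigma>_def)
  qed
  moreover have "\<sigma> x = y" by (simp add: \<sigma>_def)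
  ultimately show ?case using perm \<tau>(2) by auto
qed

text \<open>These permutations form a coset of the pointwise stabiliser of \<open>ys\<close>, which
  consists of the permutations of \<open>S - set ys\<close>.\<close>

lemma card_permutes_map_eq:
  assumes "distinct xs" "distinct ys" "length xs = length ys" "set xs \<subseteq> S" "set ys \<subseteq> S" "finite S"
  shows "card {\<pi>. \<pi> permutes S \<and> map \<pi> xs = ys} = fact (card S - length xs)"
proof -
  obtain \<tau> where \<tau>: "\<tau> permutes S" "map \<tau> xs = ys"
    using ex_permutes_map_eq assms by metis
  have eq: "{\<pi>. \<pi> permutes S \<and> map \<pi> xs = ys} = (\<lambda>\<rho>. \<rho> \<circ> \<tau>) ` {\<rho>. \<rho> permutes (S - set ys)}"
  proof (intro equalityI subsetI)
    fix \<pi> assume "\<pi> \<in> {\<pi>. \<pi> permutes S \<and> map \<pi> xs = ys}"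
    then have \<pi>: "\<pi> permutes S" "map \<pi> xs = ys" by auto
    define \<rho> where "\<rho> = \<pi> \<circ> inv \<tau>"
    have "\<rho> permutes S" unfolding \<rho>_def using \<pi> \<tau> by (intro permutes_compose permutes_inv)
    moreover have "\<rho> y = y" if "y \<in> set ys" for y
    proof -
      from that \<tau>(2) obtain x where x: "x \<in> set xs" "y = \<tau> x" by auto
      then have "\<pi> x = \<tau> x" using \<pi>(2) \<tau>(2) by (metis map_eq_conv)
      then show ?thesis using x permutes_inverses(2)[OF \<tau>(1)] by (simp add: \<rho>_def)
    qed
    ultimately have "\<rho> permutes (S - set ys)" by (auto simp: permutes_def)
    moreover have "\<pi> = \<rho> \<circ> \<tau>"
      using permutes_inverses(2)[OF \<tau>(1)] by (auto simp: \<rho>_def fun_eq_iff)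
    ultimately show "\<pi> \<in> (\<lambda>\<rho>. \<rho> \<circ> \<tau>) ` {\<rho>. \<rho> permutes (S - set ys)}" by blast
  next
    fix \<pi> assume "\<pi> \<in> (\<lambda>\<rho>. \<rho> \<circ> \<tau>) ` {\<rho>. \<rho> permutes (S - set ys)}"
    then obtain \<rho> where \<rho>: "\<rho> permutes (S - set ys)" "\<pi> = \<rho> \<circ> \<tau>" by auto
    have "\<rho> permutes S" using \<rho>(1) by (rule permutes_subset) auto
    then have "\<pi> permutes S" unfolding \<rho>(2) using \<tau> by (intro permutes_compose)
    moreover have "map \<rho> ys = ys"
      by (rule map_idI) (use permutes_not_in[OF \<rho>(1)] in auto)
    then have "map \<pi> xs = ys"
      unfolding \<rho>(2) map_map[symmetric] \<tau>(2) .
    ultimately show "\<pi> \<in> {\<pi>. \<pi> permutes S \<and> map \<pi> xs = ys}" by simp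
  qed
  have "inj_on (\<lambda>\<rho>. \<rho> \<circ> \<tau>) {\<rho>. \<rho> permutes (S - set ys)}"
  proof (rule inj_onI)
    fix \<rho> \<rho>' assume "\<rho> \<circ> \<tau> = \<rho>' \<circ> \<tau>"
    then have "\<rho> \<circ> \<tau> \<circ> inv \<tau> = \<rho>' \<circ> \<tau> \<circ> inv \<tau>" by simp
    then show "\<rho> = \<rho>'" using permutes_inv_o(1)[OF \<tau>(1)] by (simp add: o_assoc[symmetric])
  qed
  then show ?thesis
    unfolding eq using assms
    by (simp add: card_image card_permutations[OF refl] card_Diff_subset distinct_card)
qed

text \<open>
  The probability that \<open>L\<close> independent uniform elements of a set of size \<open>N\<close> are not all distinct
  (for \<open>0 < N\<close> and \<open>L \<le> N\<close>).
\<close>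

definition collision :: "nat \<Rightarrow> nat \<Rightarrow> real" where
  "collision N L = 1 - fact N / (fact (N - L) * real N ^ L)"

text \<open>Under a random permutation, \<open>R\<close> becomes uniform on the set \<open>X\<close>
  of blocks without repeated entries. In the average over all blocks, those outside \<open>X\<close>
  contribute at most \<open>C\<close> times the collision probability.\<close>

lemma permutation_average_ge:
  fixes f :: "nat list list \<Rightarrow> real"
  assumes R: "R \<in> blocks m N k" "distinct (concat R)"
    and f: "\<And>Ps. Ps \<in> blocks m N k \<Longrightarrow> 0 \<le> f Ps" "\<And>Ps. Ps \<in> blocks m N k \<Longrightarrow> f Ps \<le> C"
    and N: "0 < N"
  shows "(\<Sum>\<pi> | \<pi> permutes {..<N}. f (map (map \<pi>) R)) / fact N
           \<ge> (\<Sum>Ps\<in>blocks m N k. f Ps) / real N ^ (m * k) - C * collision N (m * k)"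
proof -
  define L where "L = m * k"
  define X where "X = {Ps \<in> blocks m N k. distinct (concat Ps)}"
  define Perm where "Perm = {\<pi>. \<pi> permutes {..<N}}"
  \<comment> \<open>The proportion of blocks without repeated entries; \<open>1 - r\<close> is the
    collision probability.\<close>
  define r where "r = fact N / (fact (N - L) * real N ^ L)"
  have finX: "finite X" by (simp add: X_def)
  have finPerm: "finite Perm" by (simp add: Perm_def finite_permutations)
  have cardPerm: "card Perm = fact N" by (simp add: Perm_def card_permutations)
  have block: "map (map \<pi>) R \<in> blocks m N k" if "\<pi> \<in> Perm" for \<pi>
  proof -
    have "map \<pi> P \<in> tuples m N" if "P \<in> tuples m N" for P
      using that \<open>\<pi> \<in> Perm\<close> permutes_image[of \<pi> "{..<N}"] by (auto simp: Perm_def tuples_def)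
    then show ?thesis using R(1) by (auto simp: blocks_def)
  qed
  have sub: "(\<lambda>\<pi>. map (map \<pi>) R) ` Perm \<subseteq> X"
  proof (intro image_subsetI)
    fix \<pi> assume \<pi>: "\<pi> \<in> Perm"
    then have "inj \<pi>" by (auto simp: Perm_def permutes_inj)
    then have "distinct (concat (map (map \<pi>) R))"
      using R(2) inj_on_subset[OF _ subset_UNIV] by (simp add: map_concat[symmetric] distinct_map)
    with block[OF \<pi>] show "map (map \<pi>) R \<in> X" by (simp add: X_def)
  qed
  have fibre: "card {\<pi> \<in> Perm. map (map \<pi>) R = Q} = fact (N - L)" if Q: "Q \<in> X" for Q
  proof -
    \<comment> \<open>All parts have length \<open>m\<close>, so blocks can be compared through
      their concatenations, where \<open>card_permutes_map_eq\<close> applies.\<close>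
    have "map (map \<pi>) R = Q \<longleftrightarrow> map \<pi> (concat R) = concat Q" if "\<pi> \<in> Perm" for \<pi>
      using concat_eq_blocks[OF block[OF that], of Q] Q by (auto simp: X_def map_concat)
    then have "{\<pi> \<in> Perm. map (map \<pi>) R = Q} = {\<pi>. \<pi> permutes {..<N} \<and> map \<pi> (concat R) = concat Q}"
      by (auto simp: Perm_def)
    also have "card \<dots> = fact (card {..<N} - length (concat R))"
      using R Q length_concat_blocks[of R m N k] length_concat_blocks[of Q m N k]
        set_concat_blocks[of R m N k] set_concat_blocks[of Q m N k]
      by (intro card_permutes_map_eq) (auto simp: X_def)
    finally show ?thesis using length_concat_blocks[OF R(1)] by (simp add: L_def)
  qed
  have group: "(\<Sum>\<pi>\<in>Perm. g (map (map \<pi>) R)) = fact (N - L) * (\<Sum>Q\<in>X. g Q)"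
    for g :: "nat list list \<Rightarrow> real"
  proof -
    have "(\<Sum>\<pi>\<in>Perm. g (map (map \<pi>) R)) =
        (\<Sum>Q\<in>X. \<Sum>\<pi>\<in>{\<pi> \<in> Perm. map (map \<pi>) R = Q}. g (map (map \<pi>) R))"
      by (rule sum.group[OF finPerm finX sub, symmetric])
    also have "\<dots> = (\<Sum>Q\<in>X. fact (N - L) * g Q)"
    proof (rule sum.cong[OF refl])
      fix Q assume "Q \<in> X"
      have "(\<Sum>\<pi>\<in>{\<pi> \<in> Perm. map (map \<pi>) R = Q}. g (map (map \<pi>) R))
          = (\<Sum>\<pi>\<in>{\<pi> \<in> Perm. map (map \<pi>) R = Q}. g Q)"
        by (rule sum.cong) auto
      then show "(\<Sum>\<pi>\<in>{\<pi> \<in> Perm. map (map \<pi>) R = Q}. g (map (map \<pi>) R)) = fact (N - L) * g Q"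
        using fibre[OF \<open>Q \<in> X\<close>] by simp
    qed
    finally show ?thesis by (simp add: sum_distrib_left)
  qed
  have cardX: "real (card X) = fact N / fact (N - L)"
    using group[of "\<lambda>_. 1"] cardPerm by (simp add: field_simps)
  have "X \<subseteq> blocks m N k" by (auto simp: X_def)
  then have le: "card X \<le> N ^ L" using card_mono[of "blocks m N k" X] by (simp add: card_blocks L_def)
  have Lpos: "0 < real N ^ L" using N by simp
  have cardX': "real (card X) = r * real N ^ L" using Lpos by (simp add: cardX r_def)
  have r: "0 < r" "r \<le> 1"
  proof -
    show "0 < r" using Lpos by (simp add: r_def)
    have "r * real N ^ L \<le> 1 * real N ^ L" using le cardX' by (metis mult_1 of_nat_le_iff of_nat_power)
    then show "r \<le> 1" using Lpos by (simp only: mult_le_cancel_right_pos)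
  qed
  have "(\<Sum>Ps\<in>blocks m N k. f Ps) = (\<Sum>Ps\<in>blocks m N k - X. f Ps) + (\<Sum>Ps\<in>X. f Ps)"
    using \<open>X \<subseteq> blocks m N k\<close> by (intro sum.subset_diff) auto
  also have "(\<Sum>Ps\<in>blocks m N k - X. f Ps) \<le> real (card (blocks m N k - X)) * C"
    using f(2) by (intro sum_bounded_above) auto
  also have "real (card (blocks m N k - X)) = real N ^ L - r * real N ^ L"
    using \<open>X \<subseteq> blocks m N k\<close> finX le cardX'
    by (simp add: card_Diff_subset card_blocks L_def of_nat_diff)
  finally have "(\<Sum>Ps\<in>blocks m N k. f Ps) - C * (1 - r) * real N ^ L \<le> (\<Sum>Ps\<in>X. f Ps)"
    by (simp add: algebra_simps)
  then have "((\<Sum>Ps\<in>blocks m N k. f Ps) - C * (1 - r) * real N ^ L) / real N ^ L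
      \<le> (\<Sum>Ps\<in>X. f Ps) / real N ^ L"
    using Lpos by (intro divide_right_mono) auto
  then have main: "(\<Sum>Ps\<in>blocks m N k. f Ps) / real N ^ L - C * (1 - r) \<le> (\<Sum>Ps\<in>X. f Ps) / real N ^ L"
    using N by (simp add: diff_divide_distrib)
  have "0 \<le> (\<Sum>Ps\<in>X. f Ps) / real N ^ L"
    using f(1) \<open>X \<subseteq> blocks m N k\<close> Lpos by (intro divide_nonneg_pos sum_nonneg) auto
  \<comment> \<open>The mean over \<open>X\<close> divides by \<open>r * real N ^ L\<close> instead
    of \<open>real N ^ L\<close>; as \<open>f\<close> is nonnegative and \<open>r \<le> 1\<close>,
    it is at least the quantity bounded so far.\<close>
  then have "(\<Sum>Ps\<in>X. f Ps) / real N ^ L * 1 \<le> (\<Sum>Ps\<in>X. f Ps) / real N ^ L * (1 / r)"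
    using r by (intro mult_left_mono) auto
  also have "\<dots> = (\<Sum>\<pi>\<in>Perm. f (map (map \<pi>) R)) / fact N"
    using N by (simp add: group r_def)
  finally show ?thesis using main by (simp add: L_def r_def collision_def Perm_def)
qed

text \<open>The complementary probability is a product of the \<open>L\<close> factors
  \<open>1 - i / N\<close>, each tending to 1.\<close>

lemma collision_tendsto_0: "(\<lambda>N. collision N L) \<longlonglongrightarrow> 0"
proof -
  have fact_eq: "N \<ge> L \<Longrightarrow> fact N / fact (N - L) = (\<Prod>i<L. real N - real i)" for N
  proof (induction L)
    case (Suc L)
    have "fact (N - L) = real (N - L) * fact (N - Suc L)"
      using Suc.prems by (metis Suc_diff_Suc Suc_le_lessD fact_Suc)
    with Suc show ?case by (simp add: field_simps of_nat_diff)
  qed simp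
  have "((\<lambda>N. 1 - (\<Prod>i<L. 1 - real i / real N)) \<longlonglongrightarrow> 1 - (\<Prod>i<L. 1 - 0))"
    by (intro tendsto_intros)
  moreover have "eventually (\<lambda>N. 1 - (\<Prod>i<L. 1 - real i / real N) = collision N L) sequentially"
    using eventually_ge_at_top[of "Suc L"]
  proof eventually_elim
    case (elim N)
    have "(\<Prod>i<L. 1 - real i / real N) = (\<Prod>i<L. (real N - real i) / real N)"
      using elim by (intro prod.cong) (auto simp: field_simps)
    also have "\<dots> = fact N / fact (N - L) / real N ^ L"
      using elim fact_eq[of N] by (simp add: prod_dividef)
    finally show ?case by (simp add: collision_def)
  qed
  ultimately have "(\<lambda>N. collision N L) \<longlonglongrightarrow> 1 - (\<Prod>i<L. 1 - 0)"
    by (rule Lim_transform_eventually)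
  then show ?thesis by simp
qed

section \<open>Independent positions\<close>

text \<open>Tuples whose first entry at or after \<open>t\<close> is \<open>a\<close> are those
  avoiding \<open>{t..<a}\<close> but not \<open>{t..<Suc a}\<close>. Entries before
  \<open>t\<close> remain allowed; this is the origin of the \<open>1 + t - x\<close> in the
  integral equation.\<close>

lemma sum_tuples_first:
  fixes \<phi> :: "nat \<Rightarrow> real"
  shows "(\<Sum>P\<in>tuples m N. if \<exists>p\<in>set P. t \<le> p then \<phi> (LEAST p. p \<in> set P \<and> t \<le> p) else 0) =
         (\<Sum>a\<in>{t..<N}. (real (N - (a - t)) ^ m - real (N - Suc (a - t)) ^ m) * \<phi> a)"
proof -
  define S where "S = {P \<in> tuples m N. \<exists>p\<in>set P. t \<le> p}"
  define first where "first P = (LEAST p. p \<in> set P \<and> t \<le> p)" for P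
  define U where "U a = {P. set P \<subseteq> {..<N} - {t..<a} \<and> length P = m}" for a
  have fin: "finite S" by (simp add: S_def)
  have first: "first P \<in> set P \<and> t \<le> first P" if "P \<in> S" for P
    unfolding first_def by (rule LeastI_ex) (use that in \<open>auto simp: S_def\<close>)
  have first_le: "first P \<le> p" if "p \<in> set P" "t \<le> p" for P p
    unfolding first_def using that by (intro Least_le) simp
  have sub: "first ` S \<subseteq> {t..<N}"
    using first by (fastforce simp: S_def tuples_def)
  have cardU: "card (U a) = (N - (a - t)) ^ m" if "t \<le> a" "a \<le> N" for a
  proof -
    have "card ({..<N} - {t..<a}) = N - (a - t)"
      using that by (subst card_Diff_subset) auto
    then show ?thesis unfolding U_def by (subst card_lists_length_eq) auto
  qed
  have finU: "finite (U a)" for a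
    unfolding U_def by (rule finite_lists_length_eq) simp
  have card: "real (card {P \<in> S. first P = a}) = real (N - (a - t)) ^ m - real (N - Suc (a - t)) ^ m"
    if a: "a \<in> {t..<N}" for a
  proof -
    have "{P \<in> S. first P = a} = U a - U (Suc a)"
    proof (intro equalityI subsetI)
      fix P assume P: "P \<in> {P \<in> S. first P = a}"
      then have "a \<in> set P" using first[of P] by auto
      moreover have "p \<notin> {t..<a}" if "p \<in> set P" for p
        using first_le[OF that] P by auto
      ultimately show "P \<in> U a - U (Suc a)"
        using P a by (auto simp: U_def S_def tuples_def)
    next
      fix P assume P: "P \<in> U a - U (Suc a)"
      then have "a \<in> set P" by (fastforce simp: U_def less_Suc_eq)
      moreover have "p \<notin> {t..<a}" if "p \<in> set P" for p
        using that P by (auto simp: U_def)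
      ultimately have "first P = a"
        unfolding first_def using a by (intro Least_equality) (auto simp: not_less)
      moreover have "P \<in> S"
        using P a \<open>a \<in> set P\<close> by (auto simp: U_def S_def tuples_def)
      ultimately show "P \<in> {P \<in> S. first P = a}" by simp
    qed
    moreover have "U (Suc a) \<subseteq> U a" by (auto simp: U_def)
    ultimately have "card {P \<in> S. first P = a} = card (U a) - card (U (Suc a))"
      and "card (U (Suc a)) \<le> card (U a)"
      using finU by (auto simp: card_Diff_subset card_mono)
    then show ?thesis using a cardU[of a] cardU[of "Suc a"] by (simp add: of_nat_diff Suc_diff_le)
  qed
  have "(\<Sum>P\<in>tuples m N. if \<exists>p\<in>set P. t \<le> p then \<phi> (first P) else 0) = (\<Sum>P\<in>S. \<phi> (first P))"
    unfolding S_def by (simp add: sum.inter_filter)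
  also have "\<dots> = (\<Sum>a\<in>{t..<N}. \<Sum>P\<in>{P \<in> S. first P = a}. \<phi> (first P))"
    by (rule sum.group[OF fin _ sub, symmetric]) simp
  also have "\<dots> = (\<Sum>a\<in>{t..<N}. real (card {P \<in> S. first P = a}) * \<phi> a)"
    by (rule sum.cong) auto
  also have "\<dots> = (\<Sum>a\<in>{t..<N}. (real (N - (a - t)) ^ m - real (N - Suc (a - t)) ^ m) * \<phi> a)"
    by (rule sum.cong) (simp_all only: card)
  finally show ?thesis unfolding first_def .
qed

text \<open>Tuples with all entries at least \<open>b\<close> and maximum \<open>a\<close> are those
  inside \<open>{b..<Suc a}\<close> but not inside \<open>{b..<a}\<close>.\<close>

lemma sum_tuples_Max:
  fixes \<phi> :: "nat \<Rightarrow> real"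
  assumes "0 < m"
  shows "(\<Sum>P\<in>tuples m N. if Min (set P) < b then 0 else \<phi> (Max (set P))) =
         (\<Sum>a\<in>{b..<N}. (real (Suc a - b) ^ m - real (a - b) ^ m) * \<phi> a)"
proof -
  define S where "S = {P \<in> tuples m N. \<not> Min (set P) < b}"
  define U where "U a = {P. set P \<subseteq> {b..<a} \<and> length P = m}" for a
  have fin: "finite S" by (simp add: S_def)
  have ne: "set P \<noteq> {}" if "length P = m" for P :: "nat list"
    using that assms by auto
  have S: "P \<in> S \<longleftrightarrow> set P \<subseteq> {b..<N} \<and> length P = m" for P
  proof (cases "length P = m")
    case True
    then show ?thesis using ne[OF True] by (auto simp: S_def tuples_def not_less)
  qed (simp add: S_def tuples_def)
  have sub: "(\<lambda>P. Max (set P)) ` S \<subseteq> {b..<N}"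
  proof (intro image_subsetI)
    fix P assume "P \<in> S"
    then have "Max (set P) \<in> set P" "set P \<subseteq> {b..<N}" using S ne by (auto intro: Max_in)
    then show "Max (set P) \<in> {b..<N}" by blast
  qed
  have cardU: "card (U a) = (a - b) ^ m" for a
    unfolding U_def by (subst card_lists_length_eq) auto
  have finU: "finite (U a)" for a
    unfolding U_def by (rule finite_lists_length_eq) simp
  have card: "real (card {P \<in> S. Max (set P) = a}) = real (Suc a - b) ^ m - real (a - b) ^ m"
    if a: "a \<in> {b..<N}" for a
  proof -
    have "{P \<in> S. Max (set P) = a} = U (Suc a) - U a"
    proof (intro equalityI subsetI)
      fix P assume P: "P \<in> {P \<in> S. Max (set P) = a}"
      then have "a \<in> set P" using Max_in[of "set P"] ne S by auto
      moreover have "p \<le> a" if "p \<in> set P" for p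
        using P that by auto
      moreover have "set P \<subseteq> {b..<N} \<and> length P = m" using P S by simp
      ultimately show "P \<in> U (Suc a) - U a"
        by (auto simp: U_def less_Suc_eq_le)
    next
      fix P assume P: "P \<in> U (Suc a) - U a"
      then have "a \<in> set P" by (fastforce simp: U_def less_Suc_eq)
      moreover have "p \<le> a" if "p \<in> set P" for p
        using that P by (auto simp: U_def)
      ultimately have "Max (set P) = a" by (intro Max_eqI) auto
      moreover have "P \<in> S"
        unfolding S using P a by (fastforce simp: U_def)
      ultimately show "P \<in> {P \<in> S. Max (set P) = a}" by simp
    qed
    moreover have "U a \<subseteq> U (Suc a)" by (auto simp: U_def)
    ultimately have "card {P \<in> S. Max (set P) = a} = card (U (Suc a)) - card (U a)"
      and "card (U a) \<le> card (U (Suc a))"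
      using finU by (auto simp: card_Diff_subset card_mono)
    then show ?thesis by (simp add: cardU of_nat_diff)
  qed
  have "(\<Sum>P\<in>tuples m N. if Min (set P) < b then 0 else \<phi> (Max (set P))) =
      (\<Sum>P\<in>tuples m N. if \<not> Min (set P) < b then \<phi> (Max (set P)) else 0)"
    by (rule sum.cong) auto
  also have "\<dots> = (\<Sum>P\<in>S. \<phi> (Max (set P)))"
    unfolding S_def by (rule sum.inter_filter[symmetric]) simp
  also have "\<dots> = (\<Sum>a\<in>{b..<N}. \<Sum>P\<in>{P \<in> S. Max (set P) = a}. \<phi> (Max (set P)))"
    by (rule sum.group[OF fin _ sub, symmetric]) simp
  also have "\<dots> = (\<Sum>a\<in>{b..<N}. real (card {P \<in> S. Max (set P) = a}) * \<phi> a)"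
    by (rule sum.cong) auto
  also have "\<dots> = (\<Sum>a\<in>{b..<N}. (real (Suc a - b) ^ m - real (a - b) ^ m) * \<phi> a)"
    by (rule sum.cong) (simp_all only: card)
  finally show ?thesis .
qed

text \<open>The expectation of \<open>chain\<close> for independent uniform positions, the discrete
  counterpart of the limit function \<open>V\<close>.\<close>

definition avg_chain :: "nat \<Rightarrow> nat \<Rightarrow> nat \<Rightarrow> nat \<Rightarrow> real" where
  "avg_chain m N k t = (\<Sum>Ps\<in>blocks m N k. real (chain t (map set Ps))) / real N ^ (m * k)"

lemma avg_chain_0 [simp]: "avg_chain m N 0 t = 0"
  by (simp add: avg_chain_def blocks_def)

lemma sum_blocks_affine:
  assumes "0 < N"
  shows "(\<Sum>Ps\<in>blocks m N k. c + real (chain t (map set Ps))) = real N ^ (m * k) * (c + avg_chain m N k t)"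
  using assms by (simp add: avg_chain_def sum.distrib card_blocks distrib_left)

text \<open>Conditioning on where the first type is hit gives the discrete form of the integral
  equation for \<open>V\<close>.\<close>

lemma avg_chain_Suc:
  assumes "0 < N"
  shows "avg_chain m N (Suc k) t =
    (\<Sum>a\<in>{t..<N}. (real (N - (a - t)) ^ m - real (N - Suc (a - t)) ^ m) / real N ^ m
        * (1 + avg_chain m N k (Suc a)))"
proof -
  define \<phi> where "\<phi> a = (\<Sum>Ps\<in>blocks m N k. 1 + real (chain (Suc a) (map set Ps)))" for a
  have \<phi>: "\<phi> a = real N ^ (m * k) * (1 + avg_chain m N k (Suc a))" for a
    unfolding \<phi>_def using assms by (rule sum_blocks_affine)
  have "(\<Sum>Ps\<in>blocks m N (Suc k). real (chain t (map set Ps))) =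
      (\<Sum>P\<in>tuples m N. if \<exists>p\<in>set P. t \<le> p then \<phi> (LEAST p. p \<in> set P \<and> t \<le> p) else 0)"
    unfolding sum_blocks_Suc \<phi>_def by (intro sum.cong) auto
  also have "\<dots> = (\<Sum>a\<in>{t..<N}. (real (N - (a - t)) ^ m - real (N - Suc (a - t)) ^ m) * \<phi> a)"
    by (rule sum_tuples_first)
  finally show ?thesis
    using assms by (simp add: avg_chain_def[of m N "Suc k"] \<phi> sum_divide_distrib power_add)
qed

definition avg_two_phase :: "nat \<Rightarrow> nat \<Rightarrow> nat \<Rightarrow> nat \<Rightarrow> real" where
  "avg_two_phase m N b k =
     (\<Sum>Ps\<in>blocks m N (Suc k). real (two_phase m b (set (hd Ps)) (map set (tl Ps)))) / real N ^ (m * Suc k)"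

text \<open>Conditioning on type 1: its minimum matters if it lies before \<open>b\<close>, and
  otherwise its maximum.\<close>

lemma avg_two_phase_eq:
  assumes "0 < N" "0 < m" "b \<le> N"
  shows "avg_two_phase m N b k =
    (\<Sum>a\<in>{0..<b}. (real (N - a) ^ m - real (N - Suc a) ^ m) / real N ^ m * (1 + avg_chain m N k (Suc a))) +
    (\<Sum>a\<in>{b..<N}. (real (Suc a - b) ^ m - real (a - b) ^ m) / real N ^ m * (real m + avg_chain m N k (Suc a)))"
proof -
  define \<phi> where "\<phi> c a = (\<Sum>Ps\<in>blocks m N k. c + real (chain (Suc a) (map set Ps)))" for c :: real and a
  have \<phi>: "\<phi> c a = real N ^ (m * k) * (c + avg_chain m N k (Suc a))" for c a
    unfolding \<phi>_def using assms(1) by (rule sum_blocks_affine)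
  \<comment> \<open>The minimum is the first entry at or after time 0, so
    \<open>sum_tuples_first\<close> with \<open>t = 0\<close> handles the first phase.\<close>
  have Least: "(\<exists>p\<in>set P. 0 \<le> p) \<and> (LEAST p. p \<in> set P \<and> 0 \<le> p) = Min (set P)"
    if "P \<in> tuples m N" for P
  proof -
    have "set P \<noteq> {}" using that assms(2) by (auto simp: tuples_def)
    then show ?thesis by (auto simp: ex_in_conv intro!: Least_equality)
  qed
  have "(\<Sum>Ps\<in>blocks m N (Suc k). real (two_phase m b (set (hd Ps)) (map set (tl Ps)))) =
      (\<Sum>P\<in>tuples m N. if Min (set P) < b then \<phi> 1 (Min (set P)) else \<phi> (real m) (Max (set P)))"
    unfolding sum_blocks_Suc \<phi>_def by (intro sum.cong) (auto simp: two_phase_def)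
  also have "\<dots> = (\<Sum>P\<in>tuples m N. if Min (set P) < b then \<phi> 1 (Min (set P)) else 0) +
      (\<Sum>P\<in>tuples m N. if Min (set P) < b then 0 else \<phi> (real m) (Max (set P)))"
    unfolding sum.distrib[symmetric] by (intro sum.cong) auto
  also have "(\<Sum>P\<in>tuples m N. if Min (set P) < b then \<phi> 1 (Min (set P)) else 0) =
      (\<Sum>P\<in>tuples m N. if \<exists>p\<in>set P. 0 \<le> p
         then (\<lambda>a. if a < b then \<phi> 1 a else 0) (LEAST p. p \<in> set P \<and> 0 \<le> p) else 0)"
    using Least by (intro sum.cong) auto
  also have "\<dots> = (\<Sum>a\<in>{0..<N}. (real (N - (a - 0)) ^ m - real (N - Suc (a - 0)) ^ m) *
      (if a < b then \<phi> 1 a else 0))"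
    by (rule sum_tuples_first)
  also have "\<dots> = (\<Sum>a\<in>{0..<b}. (real (N - a) ^ m - real (N - Suc a) ^ m) * \<phi> 1 a)"
    using assms(3) by (intro sum.mono_neutral_cong_right) auto
  also have "(\<Sum>P\<in>tuples m N. if Min (set P) < b then 0 else \<phi> (real m) (Max (set P))) =
      (\<Sum>a\<in>{b..<N}. (real (Suc a - b) ^ m - real (a - b) ^ m) * \<phi> (real m) a)"
    using assms(2) by (rule sum_tuples_Max)
  finally show ?thesis
    using assms
    by (simp add: avg_two_phase_def \<phi> add_divide_distrib sum_divide_distrib power_add)
qed

section \<open>From independent positions to the uniformly random deck\<close>

lemma permute_list_decks:
  assumes "\<pi> permutes {..<m * n}" "w \<in> decks m n"
  shows "permute_list \<pi> w \<in> decks m n"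
proof -
  have \<pi>: "\<pi> permutes {..<length w}" using assms by (simp add: decks_def)
  then have "count_list (permute_list \<pi> w) i = count_list w i" for i
    by (metis count_mset mset_permute_list)
  then show ?thesis using assms(2) \<pi> by (simp add: decks_def)
qed

text \<open>\<open>permute_list \<pi>\<close> maps the finite set of decks injectively into itself,
  hence bijectively.\<close>

lemma sum_decks_permute:
  fixes f :: "nat list \<Rightarrow> real"
  assumes "\<pi> permutes {..<m * n}"
  shows "(\<Sum>w\<in>decks m n. f (permute_list \<pi> w)) = (\<Sum>w\<in>decks m n. f w)"
proof -
  have left_inv: "permute_list (inv \<pi>) (permute_list \<pi> w) = w" if "w \<in> decks m n" for w
    using that assms permute_list_compose[of "inv \<pi>" w \<pi>]
    by (simp add: decks_def permutes_inv permutes_inv_o)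
  then have inj: "inj_on (permute_list \<pi>) (decks m n)" by (rule inj_on_inverseI)
  moreover have "permute_list \<pi> ` decks m n = decks m n"
    using permute_list_decks[OF assms] inj by (intro endo_inj_surj finite_decks) auto
  ultimately show ?thesis
    using sum.reindex[of "permute_list \<pi>" "decks m n" f] by simp
qed

text \<open>The inverse is taken so that a copy at position \<open>q\<close> moves to
  \<open>\<pi> q\<close>.\<close>

lemma occurrences_permute_list:
  assumes "\<pi> permutes {..<length w}"
  shows "occurrences (permute_list (inv \<pi>) w) j = \<pi> ` occurrences w j"
proof (intro equalityI subsetI)
  have inv: "inv \<pi> permutes {..<length w}" using assms by (rule permutes_inv)
  fix p assume p: "p \<in> occurrences (permute_list (inv \<pi>) w) j"
  then have "inv \<pi> p \<in> occurrences w j"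
    using permutes_in_image[OF inv, of p] by (auto simp: occurrences_def permute_list_nth[OF inv])
  then show "p \<in> \<pi> ` occurrences w j"
    using permutes_inverses(1)[OF assms, of p] by (metis imageI)
next
  have inv: "inv \<pi> permutes {..<length w}" using assms by (rule permutes_inv)
  fix p assume "p \<in> \<pi> ` occurrences w j"
  then obtain q where q: "p = \<pi> q" "q < length w" "w ! q = j" by (auto simp: occurrences_def)
  then have "p < length w" using permutes_in_image[OF assms, of q] by simp
  then show "p \<in> occurrences (permute_list (inv \<pi>) w) j"
    using q permutes_inverses(2)[OF assms, of q] by (simp add: occurrences_def permute_list_nth[OF inv])
qed

text \<open>For each fixed deck, averaging over all permutations of its positions gives at least
  \<open>B\<close> by \<open>permutation_average_ge\<close>. After exchanging the sums, each
  permutation drops out because it merely rearranges the decks, so the bound holds for the average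
  over decks.\<close>

lemma optimal_expected_score_ge:
  assumes m: "0 < m" and k: "Suc k \<le> n"
  shows "avg_two_phase m (m * n) b k - real (m + k) * collision (m * n) (m * Suc k)
           \<le> optimal_expected_score m n"
proof -
  define N where "N = m * n"
  define H where "H w = real (two_phase m b (occurrences w 1) (map (occurrences w) [2..<2 + k]))" for w
  define F where "F Ps = real (two_phase m b (set (hd Ps)) (map set (tl Ps)))" for Ps
  define B where "B = avg_two_phase m N b k - real (m + k) * collision N (m * Suc k)"
  define Perm where "Perm = {\<pi>. \<pi> permutes {..<N}}"
  have Npos: "0 < N" using m k by (simp add: N_def)
  have cardPerm: "card Perm = fact N" by (simp add: Perm_def card_permutations)
  have fixed: "fact N * B \<le> (\<Sum>\<pi>\<in>Perm. H (permute_list (inv \<pi>) w))" if w: "w \<in> decks m n" for w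
  proof -
    \<comment> \<open>The positions of the types 1 to \<open>k + 1\<close>, one tuple per type;
      different types occupy different positions, so the concatenation is distinct.\<close>
    define R where "R = map (\<lambda>j. sorted_list_of_set (occurrences w j)) [1..<2 + k]"
    have len: "length w = N" using w by (simp add: decks_def N_def)
    have card: "card (occurrences w j) = m" if "1 \<le> j" "j < 2 + k" for j
      using w k that by (auto simp: card_occurrences decks_def)
    have R: "R \<in> blocks m N (Suc k)"
      using card by (auto simp: R_def blocks_def tuples_def len[symmetric] occurrences_def)
    have inj: "inj_on (\<lambda>j. sorted_list_of_set (occurrences w j)) {1..<2 + k}"
    proof (rule inj_onI)
      fix i j assume ij: "i \<in> {1..<2 + k}"
        "sorted_list_of_set (occurrences w i) = sorted_list_of_set (occurrences w j)"
      then have "occurrences w i = occurrences w j"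
        by (metis finite_occurrences set_sorted_list_of_set)
      moreover have "occurrences w i \<noteq> {}" using card[of i] ij(1) m by auto
      then obtain p where "p \<in> occurrences w i" by blast
      ultimately have "p \<in> occurrences w i" "p \<in> occurrences w j" by simp_all
      then show "i = j" by (simp add: occurrences_def)
    qed
    have dist: "distinct (concat R)"
    proof (rule distinct_concat)
      show "distinct R" using inj by (simp add: R_def distinct_map del: upt_Suc)
      show "distinct P" if "P \<in> set R" for P using that by (auto simp: R_def)
      show "set P \<inter> set Q = {}" if "P \<in> set R" "Q \<in> set R" "P \<noteq> Q" for P Q
        using that by (auto simp: R_def occurrences_def)
    qed
    have F_le: "F Ps \<le> real (m + k)" if "Ps \<in> blocks m N (Suc k)" for Ps
    proof -
      have "length (map set (tl Ps)) = k" using that by (simp add: blocks_def)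
      then have "chain t (map set (tl Ps)) \<le> k" for t
        using chain_le_length[of t "map set (tl Ps)"] by simp
      from this[of "Suc (Min (set (hd Ps)))"] this[of "Suc (Max (set (hd Ps)))"]
      have "two_phase m b (set (hd Ps)) (map set (tl Ps)) \<le> m + k"
        unfolding two_phase_def using m by (auto intro: add_le_mono)
      then show ?thesis unfolding F_def by (rule of_nat_mono)
    qed
    have "B \<le> (\<Sum>\<pi> | \<pi> permutes {..<N}. F (map (map \<pi>) R)) / fact N"
      unfolding B_def avg_two_phase_def F_def[symmetric]
      using R dist _ F_le Npos by (rule permutation_average_ge) (simp add: F_def)
    then have "fact N * B \<le> (\<Sum>\<pi>\<in>Perm. F (map (map \<pi>) R))"
      by (simp add: Perm_def field_simps)
    also have "\<dots> = (\<Sum>\<pi>\<in>Perm. H (permute_list (inv \<pi>) w))"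
    proof (rule sum.cong[OF refl])
      fix \<pi> assume "\<pi> \<in> Perm"
      then have "\<pi> permutes {..<length w}" by (simp add: Perm_def len)
      then have occ: "occurrences (permute_list (inv \<pi>) w) = (\<lambda>j. \<pi> ` occurrences w j)"
        by (intro ext) (rule occurrences_permute_list)
      have "[1..<2 + k] = 1 # [2..<2 + k]" by (simp add: upt_conv_Cons numeral_2_eq_2)
      then show "F (map (map \<pi>) R) = H (permute_list (inv \<pi>) w)"
        unfolding F_def H_def occ R_def by (simp add: o_def)
    qed
    finally show ?thesis .
  qed
  define D where "D = decks m n"
  have D: "finite D" "D \<noteq> {}" by (simp_all add: D_def finite_decks decks_nonempty)
  have "fact N * (real (card D) * B) = (\<Sum>w\<in>D. fact N * B)"
    by simp
  also have "\<dots> \<le> (\<Sum>w\<in>D. \<Sum>\<pi>\<in>Perm. H (permute_list (inv \<pi>) w))"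
    using fixed by (intro sum_mono) (simp add: D_def)
  also have "\<dots> = (\<Sum>\<pi>\<in>Perm. \<Sum>w\<in>D. H (permute_list (inv \<pi>) w))"
    by (rule sum.swap)
  also have "\<dots> = (\<Sum>\<pi>\<in>Perm. \<Sum>w\<in>D. H w)"
    unfolding D_def
    by (intro sum.cong refl sum_decks_permute permutes_inv) (simp add: Perm_def N_def)
  also have "\<dots> = fact N * (\<Sum>w\<in>D. H w)"
    by (simp add: cardPerm)
  also have "\<dots> \<le> fact N * (\<Sum>w\<in>D. real (score (threshold_strategy m n b) w))"
    unfolding H_def D_def using two_phase_le_score[OF _ m k]
    by (intro mult_left_mono sum_mono of_nat_mono) auto
  finally have "real (card D) * B \<le> (\<Sum>w\<in>D. real (score (threshold_strategy m n b) w))"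
    by simp
  then have "B \<le> expected_score m n (threshold_strategy m n b)"
    using D unfolding expected_score_def D_def[symmetric]
    by (simp add: integral_pmf_of_set pos_le_divide_eq card_gt_0_iff mult.commute)
  also have "\<dots> \<le> optimal_expected_score m n"
    unfolding optimal_expected_score_def using k
    by (intro Max_ge finite_imageI finite_strategies imageI threshold_strategy_in) simp
  finally show ?thesis by (simp add: B_def N_def)
qed

section \<open>Subsolutions of the limiting integral equation\<close>

text \<open>\<open>F x * c - G x\<close> has derivative \<open>f x * (c - g x)\<close>, which is
  nonnegative. This bounds the integral of \<open>f * g\<close> using antiderivatives only.\<close>

lemma cell_bound:
  fixes F G :: "real \<Rightarrow> real"
  assumes "s \<le> s'"
    and F: "\<And>x. s \<le> x \<Longrightarrow> x \<le> s' \<Longrightarrow> (F has_real_derivative f x) (at x)"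
    and G: "\<And>x. s \<le> x \<Longrightarrow> x \<le> s' \<Longrightarrow> (G has_real_derivative f x * g x) (at x)"
    and f: "\<And>x. s \<le> x \<Longrightarrow> x \<le> s' \<Longrightarrow> 0 \<le> f x"
    and g: "\<And>x. s \<le> x \<Longrightarrow> x \<le> s' \<Longrightarrow> g x \<le> c"
  shows "G s' - G s \<le> (F s' - F s) * c"
proof -
  have "F s * c - G s \<le> F s' * c - G s'"
  proof (rule DERIV_nonneg_imp_nondecreasing[OF assms(1)])
    fix x assume x: "s \<le> x" "x \<le> s'"
    have "((\<lambda>x. F x * c - G x) has_real_derivative f x * c - f x * g x) (at x)"
      using F[OF x] G[OF x] by (auto intro!: derivative_eq_intros)
    moreover have "0 \<le> f x * c - f x * g x"
      using f[OF x] g[OF x] by (simp add: mult_left_mono)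
    ultimately show "\<exists>y. ((\<lambda>x. F x * c - G x) has_real_derivative y) (at x) \<and> 0 \<le> y"
      by blast
  qed
  then show ?thesis by (simp add: algebra_simps)
qed

text \<open>On a cell of length \<open>1 / N\<close>, \<open>g\<close> exceeds its value at the
  right end by at most \<open>M / N\<close>. Right ends occur because after a hit at
  \<open>a\<close> the next type starts at \<open>Suc a\<close>.\<close>

lemma riemann_stieltjes_sum_ge:
  fixes F G :: "real \<Rightarrow> real"
  assumes N: "0 < N" and ij: "i \<le> j"
    and F: "\<And>x. real i / real N \<le> x \<Longrightarrow> x \<le> real j / real N \<Longrightarrow> (F has_real_derivative f x) (at x)"
    and G: "\<And>x. real i / real N \<le> x \<Longrightarrow> x \<le> real j / real N \<Longrightarrow> (G has_real_derivative f x * g x) (at x)"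
    and f: "\<And>x. real i / real N \<le> x \<Longrightarrow> x \<le> real j / real N \<Longrightarrow> 0 \<le> f x"
    and g: "\<And>x y. real i / real N \<le> x \<Longrightarrow> x \<le> y \<Longrightarrow> y \<le> real j / real N \<Longrightarrow> g x - g y \<le> M * (y - x)"
    and M: "0 \<le> M"
  shows "G (real j / real N) - G (real i / real N) - M / real N * (F (real j / real N) - F (real i / real N))
    \<le> (\<Sum>a\<in>{i..<j}. (F (real (Suc a) / real N) - F (real a / real N)) * g (real (Suc a) / real N))"
proof -
  have cell: "G (real (Suc a) / real N) - G (real a / real N)
      \<le> (F (real (Suc a) / real N) - F (real a / real N)) * (g (real (Suc a) / real N) + M / real N)"
    if a: "a \<in> {i..<j}" for a
  proof (rule cell_bound)
    have lo: "real i / real N \<le> real a / real N" and hi: "real (Suc a) / real N \<le> real j / real N"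
      using a by (auto intro!: divide_right_mono simp del: of_nat_Suc)
    show "real a / real N \<le> real (Suc a) / real N" by (intro divide_right_mono) auto
    fix x assume x: "real a / real N \<le> x" "x \<le> real (Suc a) / real N"
    show "(F has_real_derivative f x) (at x)" "(G has_real_derivative f x * g x) (at x)" "0 \<le> f x"
      using F G f x lo hi by auto
    have "g x - g (real (Suc a) / real N) \<le> M * (real (Suc a) / real N - x)"
      using g x lo hi by auto
    also have "\<dots> \<le> M * (1 / real N)"
      using x N by (intro mult_left_mono[OF _ M]) (simp add: add_divide_distrib)
    finally show "g x \<le> g (real (Suc a) / real N) + M / real N" by simp
  qed
  have "G (real j / real N) - G (real i / real N) = (\<Sum>a\<in>{i..<j}. G (real (Suc a) / real N) - G (real a / real N))"
    using ij by (rule sum_Suc_diff'[symmetric])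
  also have "\<dots> \<le> (\<Sum>a\<in>{i..<j}. (F (real (Suc a) / real N) - F (real a / real N)) * (g (real (Suc a) / real N) + M / real N))"
    using cell by (rule sum_mono)
  also have "\<dots> = (\<Sum>a\<in>{i..<j}. (F (real (Suc a) / real N) - F (real a / real N)) * g (real (Suc a) / real N))
      + M / real N * (\<Sum>a\<in>{i..<j}. F (real (Suc a) / real N) - F (real a / real N))"
    unfolding distrib_left sum.distrib sum_distrib_left by (simp add: mult.commute)
  also have "(\<Sum>a\<in>{i..<j}. F (real (Suc a) / real N) - F (real a / real N)) = F (real j / real N) - F (real i / real N)"
    using ij by (rule sum_Suc_diff')
  finally show ?thesis by simp
qed

text \<open>Rescaling makes the weight an increment of \<open>- ((1 + t / N - x) ^ m)\<close>, an
  antiderivative of the density in the integral equation.\<close>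

lemma weight_eq:
  assumes "t \<le> a" "a < N"
  shows "(real (N - (a - t)) ^ m - real (N - Suc (a - t)) ^ m) / real N ^ m =
         (1 + real t / real N - real a / real N) ^ m - (1 + real t / real N - real (Suc a) / real N) ^ m"
proof -
  have "real (N - (a - t)) / real N = 1 + real t / real N - real a / real N"
    and "real (N - Suc (a - t)) / real N = 1 + real t / real N - real (Suc a) / real N"
    using assms by (auto simp: of_nat_diff field_simps)
  then show ?thesis by (simp add: diff_divide_distrib flip: power_divide)
qed

text \<open>
  Here \<open>G t\<close> is an antiderivative of the integrand \<open>m (1 + t - x)^(m - 1) (1 + p x)\<close>, so \<open>sub\<close> is the
  integral inequality for \<open>p\<close>.
\<close>

locale subsolution =
  fixes m :: nat and p :: "real \<Rightarrow> real" and G :: "real \<Rightarrow> real \<Rightarrow> real" and M C :: real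
  assumes m: "0 < m"
    and lipschitz: "\<And>x y. 0 \<le> x \<Longrightarrow> x \<le> y \<Longrightarrow> y \<le> 1 \<Longrightarrow> p x - p y \<le> M * (y - x)"
    and M: "0 \<le> M"
    and bound: "\<And>x. 0 \<le> x \<Longrightarrow> x \<le> 1 \<Longrightarrow> p x \<le> C"
    and C: "0 \<le> C"
    and G: "\<And>t x. 0 \<le> t \<Longrightarrow> t \<le> x \<Longrightarrow> x \<le> 1 \<Longrightarrow>
              (G t has_real_derivative real m * (1 + t - x) ^ (m - 1) * (1 + p x)) (at x)"
    and sub: "\<And>t. 0 \<le> t \<Longrightarrow> t \<le> 1 \<Longrightarrow> p t \<le> G t 1 - G t t"
begin

text \<open>
  In the norm weighted by \<open>exp (2 m (1 - x))\<close> the integral operator contracts by the factor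
  \<open>1 / 2\<close>, so the error of stopping after \<open>k\<close> types decays like \<open>2 ^ - k\<close> and the Riemann sum errors
  \<open>M / N\<close> of the single steps add up to at most \<open>2 M / N\<close>.
\<close>

lemma avg_chain_ge:
  assumes N: "0 < N" and t: "t \<le> N"
  shows "p (real t / real N) - (C / 2 ^ k + 2 * M / real N) * exp (2 * real m * (1 - real t / real N))
           \<le> avg_chain m N k t"
  using t
proof (induction k arbitrary: t)
  case 0
  define E where "E = exp (2 * real m * (1 - real t / real N))"
  have "1 \<le> E" using 0 N by (simp add: E_def)
  then have "C * 1 \<le> C * E" and "0 \<le> 2 * M / real N * E"
    using C M by (intro mult_left_mono mult_nonneg_nonneg; simp)+
  moreover have "p (real t / real N) \<le> C" using 0 N by (intro bound) auto
  ultimately have "p (real t / real N) - (C + 2 * M / real N) * E \<le> 0"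
    by (simp add: distrib_right)
  then show ?case by (simp add: E_def)
next
  case (Suc k)
  define \<tau> where "\<tau> = real t / real N"
  define s where "s a = real a / real N" for a
  define F where "F x = - ((1 + \<tau> - x) ^ m)" for x
  define E where "E x = exp (2 * real m * (1 - x))" for x
  \<comment> \<open>The error coefficient supplied by the induction hypothesis.\<close>
  define \<eta> where "\<eta> = C / 2 ^ k + 2 * M / real N"
  have \<tau>: "0 \<le> \<tau>" "\<tau> \<le> 1" using Suc.prems N by (auto simp: \<tau>_def)
  have \<eta>: "0 \<le> \<eta>" using C M by (simp add: \<eta>_def)
  have F': "(F has_real_derivative real m * (1 + \<tau> - x) ^ (m - 1)) (at x)" for x
    unfolding F_def by (auto intro!: derivative_eq_intros)
  have avg: "avg_chain m N (Suc k) t =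
      (\<Sum>a\<in>{t..<N}. (F (s (Suc a)) - F (s a)) * (1 + avg_chain m N k (Suc a)))"
    unfolding avg_chain_Suc[OF N] F_def s_def \<tau>_def
    by (intro sum.cong refl) (subst weight_eq, auto)
  have "p \<tau> - M / real N \<le> G \<tau> 1 - G \<tau> \<tau> - M / real N * (F 1 - F \<tau>)"
  proof -
    have "F 1 - F \<tau> \<le> 1" using \<tau> by (simp add: F_def)
    then have "M / real N * (F 1 - F \<tau>) \<le> M / real N * 1"
      using M by (intro mult_left_mono) auto
    then show ?thesis using sub[OF \<tau>] by simp
  qed
  also have "\<dots> = G \<tau> (real N / real N) - G \<tau> (real t / real N)
      - M / real N * (F (real N / real N) - F (real t / real N))"
    using N by (simp add: \<tau>_def)
  also have "\<dots> \<le> (\<Sum>a\<in>{t..<N}. (F (real (Suc a) / real N) - F (real a / real N))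
      * (1 + p (real (Suc a) / real N)))"
  proof (rule riemann_stieltjes_sum_ge[OF N Suc.prems F'])
    fix x assume "real t / real N \<le> x" "x \<le> real N / real N"
    then have x: "\<tau> \<le> x" "x \<le> 1" using N by (auto simp: \<tau>_def)
    show "(G \<tau> has_real_derivative real m * (1 + \<tau> - x) ^ (m - 1) * (1 + p x)) (at x)"
      using \<tau> x by (intro G)
    show "0 \<le> real m * (1 + \<tau> - x) ^ (m - 1)" using \<tau> x by simp
  next
    fix x y assume "real t / real N \<le> x" "x \<le> y" "y \<le> real N / real N"
    then show "1 + p x - (1 + p y) \<le> M * (y - x)"
      using lipschitz[of x y] order_trans[OF \<tau>(1), of x] N by (simp add: \<tau>_def)
  qed (rule M)
  finally have main: "p \<tau> - M / real N \<le> (\<Sum>a\<in>{t..<N}. (F (s (Suc a)) - F (s a)) * (1 + p (s (Suc a))))"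
    by (simp only: s_def)
  \<comment> \<open>The density is at most \<open>m\<close>, and \<open>E\<close> falls by at least
    \<open>2 m\<close> times the step length times its new value. The weighted sum therefore
    telescopes with a factor \<open>1 / 2\<close>.\<close>
  have cell: "(F (s (Suc a)) - F (s a)) * E (s (Suc a)) \<le> (E (s a) - E (s (Suc a))) / 2"
    if a: "a \<in> {t..<N}" for a
  proof -
    have step: "s a \<le> s (Suc a)" "\<tau> \<le> s a" "s (Suc a) \<le> 1"
      using a N by (auto simp: s_def \<tau>_def divide_right_mono)
    have "F (s (Suc a)) - F (s a) \<le> real m * (s (Suc a) - s a)"
    proof -
      have "((F (s (Suc a)) - F (s a)) :: real) \<le> (s (Suc a) - s a) * real m"
        using step \<tau> m
        by (intro cell_bound[where f = "\<lambda>_. 1" and g = "\<lambda>x. real m * (1 + \<tau> - x) ^ (m - 1)" and F = "\<lambda>x. x"])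
           (use F' in \<open>auto intro!: derivative_eq_intros power_le_one mult_left_le\<close>)
      then show ?thesis by (simp add: mult.commute)
    qed
    then have "(F (s (Suc a)) - F (s a)) * E (s (Suc a)) \<le> real m * (s (Suc a) - s a) * E (s (Suc a))"
      by (intro mult_right_mono) (auto simp: E_def)
    also have "2 * \<dots> \<le> E (s a) - E (s (Suc a))"
    proof -
      have "E (s a) = E (s (Suc a)) * exp (2 * real m * (s (Suc a) - s a))"
        by (simp add: E_def algebra_simps flip: exp_add)
      moreover have "E (s (Suc a)) * (1 + 2 * real m * (s (Suc a) - s a))
          \<le> E (s (Suc a)) * exp (2 * real m * (s (Suc a) - s a))"
        by (intro mult_left_mono exp_ge_add_one_self) (simp add: E_def)
      ultimately show ?thesis by (simp add: algebra_simps)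
    qed
    finally show ?thesis by simp
  qed
  have "(\<Sum>a\<in>{t..<N}. (F (s (Suc a)) - F (s a)) * E (s (Suc a))) \<le> (\<Sum>a\<in>{t..<N}. (E (s a) - E (s (Suc a))) / 2)"
    using cell by (rule sum_mono)
  also have "\<dots> = - (\<Sum>a\<in>{t..<N}. E (s (Suc a)) - E (s a)) / 2"
    by (simp add: sum_divide_distrib sum_negf[symmetric])
  also have "\<dots> = (E \<tau> - E 1) / 2"
    using Suc.prems N sum_Suc_diff'[of t N "\<lambda>a. E (s a)"] by (simp add: s_def \<tau>_def)
  also have "\<dots> \<le> E \<tau> / 2" by (simp add: E_def)
  finally have tail: "(\<Sum>a\<in>{t..<N}. (F (s (Suc a)) - F (s a)) * E (s (Suc a))) \<le> E \<tau> / 2" .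
  have "1 \<le> E \<tau>" using \<tau> by (simp add: E_def)
  then have "M / real N * 1 \<le> M / real N * E \<tau>" using M by (intro mult_left_mono) auto
  \<comment> \<open>Halving \<open>\<eta>\<close> leaves \<open>C / 2 ^ Suc k + M / N\<close>; the
    new Riemann error \<open>M / N\<close>, absorbed using \<open>1 \<le> E \<tau>\<close>, restores
    \<open>2 * M / N\<close>.\<close>
  then have "p \<tau> - (C / 2 ^ Suc k + 2 * M / real N) * E \<tau> \<le> p \<tau> - M / real N - \<eta> * (E \<tau> / 2)"
    by (simp add: \<eta>_def algebra_simps)
  also have "\<dots> \<le> (\<Sum>a\<in>{t..<N}. (F (s (Suc a)) - F (s a)) * (1 + p (s (Suc a))))
      - \<eta> * (\<Sum>a\<in>{t..<N}. (F (s (Suc a)) - F (s a)) * E (s (Suc a)))"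
    using main mult_left_mono[OF tail \<eta>] by simp
  also have "\<dots> = (\<Sum>a\<in>{t..<N}. (F (s (Suc a)) - F (s a)) * (1 + (p (s (Suc a)) - \<eta> * E (s (Suc a)))))"
    by (simp add: sum_distrib_left sum_subtractf[symmetric] algebra_simps)
  also have "\<dots> \<le> avg_chain m N (Suc k) t"
    unfolding avg
  proof (rule sum_mono)
    fix a assume a: "a \<in> {t..<N}"
    then have "s (Suc a) \<le> 1" "s a \<le> s (Suc a)" using N by (auto simp: s_def divide_right_mono)
    then have "0 \<le> F (s (Suc a)) - F (s a)"
      using \<tau> by (simp add: F_def power_mono)
    moreover have "p (s (Suc a)) - \<eta> * E (s (Suc a)) \<le> avg_chain m N k (Suc a)"
      using Suc.IH[of "Suc a"] a by (simp add: s_def E_def \<eta>_def)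
    ultimately show "(F (s (Suc a)) - F (s a)) * (1 + (p (s (Suc a)) - \<eta> * E (s (Suc a))))
        \<le> (F (s (Suc a)) - F (s a)) * (1 + avg_chain m N k (Suc a))"
      by (intro mult_left_mono) auto
  qed
  finally show ?case by (simp only: \<tau>_def E_def)
qed

text \<open>Both sums of \<open>avg_two_phase_eq\<close> are compared with their integrals, with
  antiderivative \<open>G 0\<close> before the threshold and \<open>H\<close> after it.\<close>

lemma avg_two_phase_ge:
  assumes N: "0 < N" and b: "b \<le> N"
    and H: "\<And>x. real b / real N \<le> x \<Longrightarrow> x \<le> 1 \<Longrightarrow>
              (H has_real_derivative real m * (x - real b / real N) ^ (m - 1) * (real m + p x)) (at x)"
    and chain: "\<And>t. t \<le> N \<Longrightarrow> p (real t / real N) - \<epsilon> \<le> avg_chain m N k t"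
  shows "G 0 (real b / real N) - G 0 0 + (H 1 - H (real b / real N)) - (M / real N + \<epsilon>)
           \<le> avg_two_phase m N b k"
proof -
  define c where "c = real b / real N"
  define s where "s a = real a / real N" for a
  define F1 where "F1 x = - ((1 - x) ^ m)" for x :: real
  define F2 where "F2 x = (x - c) ^ m" for x
  have c: "0 \<le> c" "c \<le> 1" using b N by (auto simp: c_def)
  have F1': "(F1 has_real_derivative real m * (1 - x) ^ (m - 1)) (at x)" for x
    unfolding F1_def by (auto intro!: derivative_eq_intros)
  have F2': "(F2 has_real_derivative real m * (x - c) ^ (m - 1)) (at x)" for x
    unfolding F2_def by (auto intro!: derivative_eq_intros)
  have W1: "(real (N - a) ^ m - real (N - Suc a) ^ m) / real N ^ m = F1 (s (Suc a)) - F1 (s a)"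
    if "a < b" for a
    using weight_eq[of 0 a N m] that b by (simp add: F1_def s_def)
  have W2: "(real (Suc a - b) ^ m - real (a - b) ^ m) / real N ^ m = F2 (s (Suc a)) - F2 (s a)"
    if "b \<le> a" for a
  proof -
    have "real (Suc a - b) / real N = s (Suc a) - c" "real (a - b) / real N = s a - c"
      using that by (auto simp: s_def c_def of_nat_diff diff_divide_distrib)
    then show ?thesis by (simp add: F2_def diff_divide_distrib flip: power_divide)
  qed
  have avg: "avg_two_phase m N b k =
      (\<Sum>a\<in>{0..<b}. (F1 (s (Suc a)) - F1 (s a)) * (1 + avg_chain m N k (Suc a))) +
      (\<Sum>a\<in>{b..<N}. (F2 (s (Suc a)) - F2 (s a)) * (real m + avg_chain m N k (Suc a)))"
    unfolding avg_two_phase_eq[OF N m b]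
    by (intro arg_cong2[of _ _ _ _ "(+)"] sum.cong refl) (simp_all only: W1 W2 atLeastLessThan_iff)
  \<comment> \<open>The increments are the probabilities \<open>1 - (1 - c) ^ m\<close> and
    \<open>(1 - c) ^ m\<close> of the two phases; since they add up to 1, the errors
    \<open>M / N\<close> and \<open>\<epsilon>\<close> enter only once.\<close>
  have total: "F1 c - F1 0 + (F2 1 - F2 c) = 1"
    using m by (simp add: F1_def F2_def)
  have "G 0 (real b / real N) - G 0 (real 0 / real N) - M / real N * (F1 (real b / real N) - F1 (real 0 / real N))
      \<le> (\<Sum>a\<in>{0..<b}. (F1 (real (Suc a) / real N) - F1 (real a / real N)) * (1 + p (real (Suc a) / real N)))"
  proof (rule riemann_stieltjes_sum_ge[OF N _ F1'])
    fix x assume "real 0 / real N \<le> x" "x \<le> real b / real N"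
    then have x: "0 \<le> x" "x \<le> 1" using c by (auto simp: c_def)
    show "(G 0 has_real_derivative real m * (1 - x) ^ (m - 1) * (1 + p x)) (at x)"
      using G[of 0 x] x by simp
    show "0 \<le> real m * (1 - x) ^ (m - 1)" using x by simp
  next
    fix x y assume "real 0 / real N \<le> x" "x \<le> y" "y \<le> real b / real N"
    then show "1 + p x - (1 + p y) \<le> M * (y - x)"
      using lipschitz[of x y] c by (simp add: c_def)
  qed (auto simp: M)
  then have part1: "G 0 c - G 0 0 - M / real N * (F1 c - F1 0)
      \<le> (\<Sum>a\<in>{0..<b}. (F1 (s (Suc a)) - F1 (s a)) * (1 + p (s (Suc a))))"
    by (simp only: s_def c_def of_nat_0 div_0)
  have "H (real N / real N) - H (real b / real N) - M / real N * (F2 (real N / real N) - F2 (real b / real N))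
      \<le> (\<Sum>a\<in>{b..<N}. (F2 (real (Suc a) / real N) - F2 (real a / real N)) * (real m + p (real (Suc a) / real N)))"
  proof (rule riemann_stieltjes_sum_ge[OF N b F2'])
    fix x assume "real b / real N \<le> x" "x \<le> real N / real N"
    then have x: "c \<le> x" "x \<le> 1" using N by (auto simp: c_def)
    show "(H has_real_derivative real m * (x - c) ^ (m - 1) * (real m + p x)) (at x)"
      using H[of x] x by (simp add: c_def)
    show "0 \<le> real m * (x - c) ^ (m - 1)" using x by simp
  next
    fix x y assume "real b / real N \<le> x" "x \<le> y" "y \<le> real N / real N"
    then show "real m + p x - (real m + p y) \<le> M * (y - x)"
      using lipschitz[of x y] order_trans[OF c(1), of x] N by (simp add: c_def)
  qed (rule M)
  then have part2: "H 1 - H c - M / real N * (F2 1 - F2 c)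
      \<le> (\<Sum>a\<in>{b..<N}. (F2 (s (Suc a)) - F2 (s a)) * (real m + p (s (Suc a))))"
    using N by (simp add: s_def c_def)
  have lower: "(\<Sum>a\<in>{i..<j}. (F (s (Suc a)) - F (s a)) * (d + p (s (Suc a)))) - \<epsilon> * (F (s j) - F (s i))
      \<le> (\<Sum>a\<in>{i..<j}. (F (s (Suc a)) - F (s a)) * (d + avg_chain m N k (Suc a)))"
    if "i \<le> j" "j \<le> N" "\<And>a. a \<in> {i..<j} \<Longrightarrow> F (s a) \<le> F (s (Suc a))" for F :: "real \<Rightarrow> real" and d i j
  proof -
    have "(\<Sum>a\<in>{i..<j}. (F (s (Suc a)) - F (s a)) * (d + p (s (Suc a)))) - \<epsilon> * (F (s j) - F (s i))
        = (\<Sum>a\<in>{i..<j}. (F (s (Suc a)) - F (s a)) * (d + p (s (Suc a)))) - \<epsilon> * (\<Sum>a\<in>{i..<j}. F (s (Suc a)) - F (s a))"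
      using sum_Suc_diff'[OF that(1), of "\<lambda>a. F (s a)"] by simp
    also have "\<dots> = (\<Sum>a\<in>{i..<j}. (F (s (Suc a)) - F (s a)) * (d + (p (s (Suc a)) - \<epsilon>)))"
      by (simp add: sum_distrib_left sum_subtractf[symmetric] algebra_simps)
    also have "\<dots> \<le> (\<Sum>a\<in>{i..<j}. (F (s (Suc a)) - F (s a)) * (d + avg_chain m N k (Suc a)))"
      using that chain by (intro sum_mono mult_left_mono) (auto simp: s_def simp del: of_nat_Suc)
    finally show ?thesis .
  qed
  have "F1 (s a) \<le> F1 (s (Suc a))" if "a \<in> {0..<b}" for a
    using that b by (auto simp: F1_def s_def intro!: power_mono divide_right_mono)
  from lower[of 0 b F1 1, OF _ b this]
  have low1: "(\<Sum>a\<in>{0..<b}. (F1 (s (Suc a)) - F1 (s a)) * (1 + p (s (Suc a)))) - \<epsilon> * (F1 c - F1 0)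
      \<le> (\<Sum>a\<in>{0..<b}. (F1 (s (Suc a)) - F1 (s a)) * (1 + avg_chain m N k (Suc a)))"
    by (simp add: s_def c_def)
  have "F2 (s a) \<le> F2 (s (Suc a))" if "a \<in> {b..<N}" for a
    using that by (auto simp: F2_def s_def c_def intro!: power_mono divide_right_mono)
  from lower[of b N F2 "real m", OF b _ this]
  have low2: "(\<Sum>a\<in>{b..<N}. (F2 (s (Suc a)) - F2 (s a)) * (real m + p (s (Suc a)))) - \<epsilon> * (F2 1 - F2 c)
      \<le> (\<Sum>a\<in>{b..<N}. (F2 (s (Suc a)) - F2 (s a)) * (real m + avg_chain m N k (Suc a)))"
    using N by (simp add: s_def c_def)
  have "(M / real N + \<epsilon>) * (F1 c - F1 0 + (F2 1 - F2 c)) = M / real N + \<epsilon>"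
    unfolding total by simp
  then have "G 0 c - G 0 0 + (H 1 - H c) - (M / real N + \<epsilon>) =
      (G 0 c - G 0 0 - M / real N * (F1 c - F1 0) - \<epsilon> * (F1 c - F1 0)) +
      (H 1 - H c - M / real N * (F2 1 - F2 c) - \<epsilon> * (F2 1 - F2 c))"
    by (simp add: algebra_simps)
  also have "\<dots> \<le> avg_two_phase m N b k"
    unfolding avg using part1 part2 low1 low2 by linarith
  finally show ?thesis by (simp add: c_def)
qed

text \<open>\<open>W c\<close> is the limiting bound for threshold \<open>c\<close>. First
  \<open>k\<close> is fixed so large that the truncation error is below half the slack; for this
  \<open>k\<close>, all other errors, including the collision term, vanish as \<open>N\<close>
  grows.\<close>

lemma optimal_expected_score_eventually_ge:
  fixes W :: "real \<Rightarrow> real"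
  assumes H: "\<And>c x. 0 \<le> c \<Longrightarrow> c \<le> x \<Longrightarrow> x \<le> 1 \<Longrightarrow>
              (H c has_real_derivative real m * (x - c) ^ (m - 1) * (real m + p x)) (at x)"
    and W: "\<And>c. W c = G 0 c - G 0 0 + (H c 1 - H c c)"
    and cont: "continuous_on UNIV W" and L: "L < W (1 / 4)"
  shows "eventually (\<lambda>n. L \<le> optimal_expected_score m n) sequentially"
proof -
  define e where "e = exp (2 * real m)"
  define \<delta> where "\<delta> = W (1 / 4) - L"
  have \<delta>: "0 < \<delta>" using L by (simp add: \<delta>_def)
  have "(\<lambda>k. C * e * (1 / 2) ^ k) \<longlonglongrightarrow> C * e * 0"
    by (intro tendsto_mult_left LIMSEQ_realpow_zero) auto
  then have "eventually (\<lambda>k. C * e * (1 / 2) ^ k < \<delta> / 2) sequentially"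
    using \<delta> by (intro order_tendstoD) auto
  then obtain k where k: "C * e * (1 / 2) ^ k < \<delta> / 2"
    by (auto simp: eventually_sequentially)
  define err where "err N = M / real N + (C / 2 ^ k + 2 * M / real N) * e
      + real (m + k) * collision N (m * Suc k)" for N
  have "(\<lambda>N. real (N div 4) / real N) \<longlonglongrightarrow> 1 / 4"
  proof (rule tendsto_sandwich)
    show "(\<lambda>N. 1 / 4 - 1 / real N) \<longlonglongrightarrow> 1 / 4"
      using tendsto_diff[OF tendsto_const lim_const_over_n[of "1::real"], of "1 / 4"] by simp
    show "eventually (\<lambda>N. 1 / 4 - 1 / real N \<le> real (N div 4) / real N) sequentially"
      using eventually_gt_at_top[of 0]
    proof eventually_elim
      case (elim N)
      have "N \<le> 4 * (N div 4) + 4" by presburger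
      then have "real N \<le> 4 * real (N div 4) + 4" by linarith
      then have "(real N - 4) / 4 \<le> real (N div 4)" by simp
      then have "(real N - 4) / 4 / real N \<le> real (N div 4) / real N"
        by (rule divide_right_mono) simp
      then show ?case using elim by (simp add: diff_divide_distrib)
    qed
    show "eventually (\<lambda>N. real (N div 4) / real N \<le> 1 / 4) sequentially"
      using eventually_gt_at_top[of 0]
    proof eventually_elim
      case (elim N)
      have "4 * (N div 4) \<le> N" by presburger
      then have "4 * real (N div 4) \<le> real N" by linarith
      then show ?case using elim by (simp add: field_simps)
    qed
  qed simp
  then have "(\<lambda>N. W (real (N div 4) / real N)) \<longlonglongrightarrow> W (1 / 4)"
    using cont by (intro isCont_tendsto_compose[where g = W]) (auto simp: continuous_on_eq_continuous_at)
  then have "(\<lambda>N. W (real (N div 4) / real N) - err N)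
      \<longlonglongrightarrow> W (1 / 4) - (0 + (C / 2 ^ k + 0) * e + real (m + k) * 0)"
    unfolding err_def
    by (intro tendsto_diff tendsto_add tendsto_mult tendsto_const lim_const_over_n collision_tendsto_0)
  moreover have "L < W (1 / 4) - (0 + (C / 2 ^ k + 0) * e + real (m + k) * 0)"
    using k \<delta> by (simp add: \<delta>_def power_divide)
  ultimately have "eventually (\<lambda>N. L < W (real (N div 4) / real N) - err N) sequentially"
    by (rule order_tendstoD)
  moreover have "filterlim (\<lambda>n. m * n) sequentially sequentially"
    using m by (rule mult_nat_left_at_top)
  ultimately have "eventually (\<lambda>n. L < W (real (m * n div 4) / real (m * n)) - err (m * n)) sequentially"
    by (rule eventually_compose_filterlim)
  then show ?thesis
    using eventually_ge_at_top[of "Suc k"]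
  proof eventually_elim
    case (elim n)
    define N where "N = m * n"
    define b where "b = N div 4"
    have N: "0 < N" using elim m by (simp add: N_def)
    have b: "b \<le> N" by (simp add: b_def)
    have "p (real t / real N) - (C / 2 ^ k + 2 * M / real N) * e \<le> avg_chain m N k t" if "t \<le> N" for t
    proof -
      \<comment> \<open>The exponential is largest at \<open>t = 0\<close>, so \<open>e\<close>
        makes the error uniform in \<open>t\<close>.\<close>
      have "(C / 2 ^ k + 2 * M / real N) * exp (2 * real m * (1 - real t / real N))
          \<le> (C / 2 ^ k + 2 * M / real N) * e"
        using C M unfolding e_def
        by (intro mult_left_mono) (auto intro!: mult_left_le)
      then show ?thesis using avg_chain_ge[OF N that, of k] by linarith
    qed
    from avg_two_phase_ge[OF N b H this]
    have "W (real b / real N) - (M / real N + (C / 2 ^ k + 2 * M / real N) * e) \<le> avg_two_phase m N b k"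
      unfolding W by auto
    then have "W (real b / real N) - err N \<le> avg_two_phase m N b k - real (m + k) * collision N (m * Suc k)"
      by (simp add: err_def)
    also have "\<dots> \<le> optimal_expected_score m n"
      unfolding N_def using m elim(2) by (rule optimal_expected_score_ge)
    finally show ?case using elim(1) by (simp add: N_def b_def)
  qed
qed

end

section \<open>Explicit polynomials for two and three copies\<close>

text \<open>
  The polynomials \<open>p\<close> below are found from the power series of \<open>V\<close> in \<open>y = 1 - x\<close>. For \<open>m = 3\<close> it
  is truncated after \<open>y ^ 4\<close>; for \<open>m = 2\<close> it begins \<open>2 y + y ^ 2 - y ^ 4 / 6 - y ^ 5 / 15\<close>, and
  \<open>- y ^ 4 / 4\<close> replaces everything from degree 4 on.
\<close>

lemma eventually_score_two: "eventually (\<lambda>n. 2.91 \<le> optimal_expected_score 2 n) sequentially"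
proof -
  define p :: "real \<Rightarrow> real" where "p x = 2 * (1 - x) + (1 - x) ^ 2 - (1 - x) ^ 4 / 4" for x
  \<comment> \<open>With \<open>y = 1 - x\<close>, these are the antiderivatives of
    \<open>1 + p\<close> and of \<open>y (1 + p)\<close> that vanish at \<open>y = 0\<close>. They
    give \<open>G\<close> through \<open>1 + t - x = t + y\<close>; the minus sign comes from the
    reversed direction of \<open>y\<close>.\<close>
  define Q1 Q2 :: "real \<Rightarrow> real" where
    "Q1 y = y + y ^ 2 + y ^ 3 / 3 - y ^ 5 / 20" and
    "Q2 y = y ^ 2 / 2 + 2 * y ^ 3 / 3 + y ^ 4 / 4 - y ^ 6 / 24" for y
  define G where "G t x = - 2 * (t * Q1 (1 - x) + Q2 (1 - x))" for t x
  \<comment> \<open>Here \<open>x - c = (1 - c) - y\<close>, and the extra terms account for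
    \<open>2 + p = (1 + p) + 1\<close>.\<close>
  define H where "H c x = - 2 * ((1 - c) * (Q1 (1 - x) + (1 - x)) - (Q2 (1 - x) + (1 - x) ^ 2 / 2))" for c x
  define W where "W c = G 0 c - G 0 0 + (H c 1 - H c c)" for c
  interpret subsolution 2 p G 4 4
  proof
    fix x y :: real assume xy: "0 \<le> x" "x \<le> y" "y \<le> 1"
    have "p x + 4 * x \<le> p y + 4 * y"
    proof (rule DERIV_nonneg_imp_nondecreasing[OF xy(2)])
      fix z assume "x \<le> z" "z \<le> y"
      then have z: "0 \<le> z" "z \<le> 1" using xy by auto
      have "((\<lambda>x. p x + 4 * x) has_real_derivative 2 * z + (1 - z) ^ 3) (at z)"
        unfolding p_def by (auto intro!: derivative_eq_intros simp: field_simps)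
      moreover have "0 \<le> 2 * z + (1 - z) ^ 3" using z by simp
      ultimately show "\<exists>d. ((\<lambda>x. p x + 4 * x) has_real_derivative d) (at z) \<and> 0 \<le> d"
        by blast
    qed
    then show "p x - p y \<le> 4 * (y - x)" by simp
  next
    fix x :: real assume x: "0 \<le> x" "x \<le> 1"
    have "(1 - x) ^ 2 \<le> 1" "0 \<le> (1 - x) ^ 4" using x by (auto intro: power_le_one)
    moreover have "2 * y + a - b / 4 \<le> 4" if "y \<le> 1" "a \<le> 1" "0 \<le> b" for y a b :: real
      using that by linarith
    ultimately show "p x \<le> 4" using x by (simp only: p_def)
  next
    fix t x :: real
    show "(G t has_real_derivative real 2 * (1 + t - x) ^ (2 - 1) * (1 + p x)) (at x)"
      unfolding G_def Q1_def Q2_def p_def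
      by (auto intro!: derivative_eq_intros simp: field_simps) algebra
  next
    fix t :: real assume t: "0 \<le> t" "t \<le> 1"
    \<comment> \<open>The defect of the integral inequality factors explicitly, which makes its sign
      on \<open>[0, 1]\<close> visible.\<close>
    have "G t 1 - G t t - p t = (1 - t) ^ 4 * (t * (4 + t)) / 60"
      unfolding G_def Q1_def Q2_def p_def by (simp add: field_simps) algebra
    moreover have "0 \<le> (1 - t) ^ 4 * (t * (4 + t)) / 60" using t by simp
    ultimately show "p t \<le> G t 1 - G t t" by simp
  qed auto
  show ?thesis
  proof (rule optimal_expected_score_eventually_ge[where H = H and W = W])
    fix c x :: real
    show "(H c has_real_derivative real 2 * (x - c) ^ (2 - 1) * (real 2 + p x)) (at x)"
      unfolding H_def Q1_def Q2_def p_def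
      by (auto intro!: derivative_eq_intros simp: field_simps) algebra
    show "W c = G 0 c - G 0 0 + (H c 1 - H c c)" by (rule W_def)
    show "continuous_on UNIV W"
      unfolding W_def[abs_def] H_def G_def Q1_def Q2_def by (intro continuous_intros) auto
    show "2.91 < W (1 / 4)"
      unfolding W_def H_def G_def Q1_def Q2_def by (simp add: power_divide)
  qed
qed

lemma eventually_score_three: "eventually (\<lambda>n. 3.97 \<le> optimal_expected_score 3 n) sequentially"
proof -
  define p :: "real \<Rightarrow> real" where
    "p x = 3 * (1 - x) + 3 / 2 * (1 - x) ^ 2 - (1 - x) ^ 3 / 2 - 3 / 8 * (1 - x) ^ 4" for x
  \<comment> \<open>Antiderivatives in \<open>y = 1 - x\<close> of \<open>1 + p\<close>,
    \<open>y (1 + p)\<close> and \<open>y ^ 2 (1 + p)\<close>, matching the expansion of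
    \<open>(t + y) ^ 2\<close>.\<close>
  define Q1 Q2 Q3 :: "real \<Rightarrow> real" where
    "Q1 y = y + 3 / 2 * y ^ 2 + y ^ 3 / 2 - y ^ 4 / 8 - 3 / 40 * y ^ 5" and
    "Q2 y = y ^ 2 / 2 + y ^ 3 + 3 / 8 * y ^ 4 - y ^ 5 / 10 - y ^ 6 / 16" and
    "Q3 y = y ^ 3 / 3 + 3 / 4 * y ^ 4 + 3 / 10 * y ^ 5 - y ^ 6 / 12 - 3 / 56 * y ^ 7" for y
  define G where "G t x = - 3 * (t ^ 2 * Q1 (1 - x) + 2 * t * Q2 (1 - x) + Q3 (1 - x))" for t x
  define H where "H c x = - 3 * ((1 - c) ^ 2 * (Q1 (1 - x) + 2 * (1 - x))
      - 2 * (1 - c) * (Q2 (1 - x) + (1 - x) ^ 2) + (Q3 (1 - x) + 2 / 3 * (1 - x) ^ 3))" for c x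
  define W where "W c = G 0 c - G 0 0 + (H c 1 - H c c)" for c
  interpret subsolution 3 p G 6 6
  proof
    fix x y :: real assume xy: "0 \<le> x" "x \<le> y" "y \<le> 1"
    have "p x + 6 * x \<le> p y + 6 * y"
    proof (rule DERIV_nonneg_imp_nondecreasing[OF xy(2)])
      fix z assume "x \<le> z" "z \<le> y"
      then have z: "0 \<le> z" "z \<le> 1" using xy by auto
      have "((\<lambda>x. p x + 6 * x) has_real_derivative 3 * z + 3 / 2 * (1 - z) ^ 2 + 3 / 2 * (1 - z) ^ 3) (at z)"
        unfolding p_def by (auto intro!: derivative_eq_intros simp: field_simps)
      moreover have "0 \<le> 3 * z + 3 / 2 * (1 - z) ^ 2 + 3 / 2 * (1 - z) ^ 3" using z by simp
      ultimately show "\<exists>d. ((\<lambda>x. p x + 6 * x) has_real_derivative d) (at z) \<and> 0 \<le> d"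
        by blast
    qed
    then show "p x - p y \<le> 6 * (y - x)" by simp
  next
    fix x :: real assume x: "0 \<le> x" "x \<le> 1"
    have "(1 - x) ^ 2 \<le> 1" "0 \<le> (1 - x) ^ 3" "0 \<le> (1 - x) ^ 4" using x by (auto intro: power_le_one)
    moreover have "3 * y + 3 / 2 * a - b / 2 - 3 / 8 * d \<le> 6"
      if "y \<le> 1" "a \<le> 1" "0 \<le> b" "0 \<le> d" for y a b d :: real
      using that by linarith
    ultimately show "p x \<le> 6" using x by (simp only: p_def)
  next
    fix t x :: real
    show "(G t has_real_derivative real 3 * (1 + t - x) ^ (3 - 1) * (1 + p x)) (at x)"
      unfolding G_def Q1_def Q2_def Q3_def p_def
      by (auto intro!: derivative_eq_intros simp: field_simps) algebra
  next
    fix t :: real assume t: "0 \<le> t" "t \<le> 1"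
    \<comment> \<open>The factor \<open>(1 - t) ^ 5\<close> reflects agreement with the series up to
      degree 4; the quadratic factor is at least 21 on \<open>[0, 1]\<close>.\<close>
    have "G t 1 - G t t - p t = (1 - t) ^ 5 * (32 - 8 * t - 3 * t ^ 2) / 280"
      unfolding G_def Q1_def Q2_def Q3_def p_def by (simp add: field_simps) algebra
    moreover have "0 \<le> (1 - t) ^ 5 * (32 - 8 * t - 3 * t ^ 2) / 280"
      using t power_le_one[of t 2] by (intro divide_nonneg_pos mult_nonneg_nonneg) auto
    ultimately show "p t \<le> G t 1 - G t t" by simp
  qed auto
  show ?thesis
  proof (rule optimal_expected_score_eventually_ge[where H = H and W = W])
    fix c x :: real
    show "(H c has_real_derivative real 3 * (x - c) ^ (3 - 1) * (real 3 + p x)) (at x)"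
      unfolding H_def Q1_def Q2_def Q3_def p_def
      by (auto intro!: derivative_eq_intros simp: field_simps) algebra
    show "W c = G 0 c - G 0 0 + (H c 1 - H c c)" by (rule W_def)
    show "continuous_on UNIV W"
      unfolding W_def[abs_def] H_def G_def Q1_def Q2_def Q3_def by (intro continuous_intros) auto
    show "3.97 < W (1 / 4)"
      unfolding W_def H_def G_def Q1_def Q2_def Q3_def by (simp add: power_divide)
  qed
qed

theorem theorem2:
  shows "\<exists>N. \<forall>n\<ge>N. optimal_expected_score 2 n \<ge> 2.91 \<and> optimal_expected_score 3 n \<ge> 3.97"
  using eventually_conj[OF eventually_score_two eventually_score_three]
  unfolding eventually_sequentially .

end
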